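(* Let $q$ be an odd prime power, $\mu\in\mathbb F_q^\times$, and $\Delta\in\mathbb F_{q^2}^\times$ with $\Delta^q=-\Delta$. Let $\chi\neq1$ be a multiplicative character of $\mathbb F_{q^4}^\times$ whose order $d$ divides $q^2-1$, and let $S_\chi=\sum_{P\in\mathscr C_\Delta(\mathbb F_q)}\chi(\mu b(P))$. Then $$|S_\chi|\leq\begin{cases}2\sqrt q,&d\mid q+1,\\ 4\sqrt q,&d\nmid q+1.\end{cases}$$
   Context: Set $V_-=\{w\in\mathbb F_{q^4}:w^{q^2}=-w\}$ (a two-dimensional $\mathbb F_q$-space) and $\Phi(w)=w^2-w^{2q}$. $\mathscr C_\Delta$ is the smooth projective conic over $\mathbb F_q$ with $\mathscr C_\Delta(\mathbb F_q)=\{[u:w]\in\mathbb P(\mathbb F_q\oplus V_-):\Phi(w)=\Delta u^2\}$; every such point has $u\neq0$. The root function is $b([u:w])=(w-u/2)/u\in\mathbb F_{q^4}$. Characters are complex-valued and extended by $\chi(0)=0$. *)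

theory Defs
  imports Complex_Main "HOL-Library.Cardinality" "HOL-Number_Theory.Prime_Powers"
begin

text \<open>
  The ambient type \<open>'a\<close> plays the role of a field with \<open>q^4\<close> elements; the theorem
  assumes \<open>CARD('a) = q^4\<close>. If \<open>CARD('a)\<close> is a power of \<open>r\<close>, then
  \<open>fixed_subfield r\<close> is the unique subfield with \<open>r\<close> elements.
\<close>

definition fixed_subfield :: "nat \<Rightarrow> 'a::field set" where
  "fixed_subfield r = {x. x ^ r = x}"

definition V_minus :: "nat \<Rightarrow> 'a::field set" where
  "V_minus q = {w. w ^ (q\<^sup>2) = - w}"

definition Phi :: "nat \<Rightarrow> 'a::field \<Rightarrow> 'a" where
  "Phi q w = w\<^sup>2 - w ^ (2 * q)"

definition nonzero_vectors :: "nat \<Rightarrow> ('a::field \<times> 'a) set" where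
  "nonzero_vectors q = (fixed_subfield q \<times> V_minus q) - {(0, 0)}"

definition scaling_rel :: "nat \<Rightarrow> (('a::field \<times> 'a) \<times> ('a \<times> 'a)) set" where
  "scaling_rel q =
    {((u, w), (u', w')). (u, w) \<in> nonzero_vectors q \<and> (u', w') \<in> nonzero_vectors q \<and>
       (\<exists>c \<in> fixed_subfield q - {0}. u' = c * u \<and> w' = c * w)}"

text \<open>A point of the projective space of \<open>fixed_subfield q \<times> V_minus q\<close> is a
  \<open>scaling_rel\<close>-class; \<open>proj_point q u w\<close> is the point with homogeneous coordinates
  \<open>u, w\<close>.\<close>

definition proj_point :: "nat \<Rightarrow> 'a::field \<Rightarrow> 'a \<Rightarrow> ('a \<times> 'a) set" where
  "proj_point q u w = scaling_rel q `` {(u, w)}"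

text \<open>The points of the conic that are rational over the field with \<open>q\<close> elements.\<close>

definition conic_points :: "nat \<Rightarrow> 'a::field \<Rightarrow> ('a \<times> 'a) set set" where
  "conic_points q \<Delta> =
    {proj_point q u w | u w. (u, w) \<in> nonzero_vectors q \<and> Phi q w = \<Delta> * u\<^sup>2}"

text \<open>The value does not depend on the representative; see \<open>root_fun_proj_point\<close>.\<close>

definition root_fun :: "('a::field \<times> 'a) set \<Rightarrow> 'a" where
  "root_fun P = the_elem ((\<lambda>(u, w). (w - u / 2) / u) ` P)"

text \<open>Complex characters of the multiplicative group, extended by zero.\<close>

definition mult_character :: "('a::field \<Rightarrow> complex) \<Rightarrow> bool" where
  "mult_character \<chi> \<longleftrightarrow>
     \<chi> 0 = 0 \<and> (\<forall>x. x \<noteq> 0 \<longrightarrow> \<chi> x \<noteq> 0) \<and>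
     (\<forall>x y. x \<noteq> 0 \<longrightarrow> y \<noteq> 0 \<longrightarrow> \<chi> (x * y) = \<chi> x * \<chi> y)"

definition trivial_character :: "'a::field \<Rightarrow> complex" where
  "trivial_character x = (if x = 0 then 0 else 1)"

definition character_order :: "('a::field \<Rightarrow> complex) \<Rightarrow> nat" where
  "character_order \<chi> = (LEAST n. n > 0 \<and> (\<lambda>x. \<chi> x ^ n) = trivial_character)"

definition conic_sum :: "nat \<Rightarrow> 'a::field \<Rightarrow> 'a \<Rightarrow> ('a \<Rightarrow> complex) \<Rightarrow> complex" where
  "conic_sum q \<mu> \<Delta> \<chi> = (\<Sum>P \<in> conic_points q \<Delta>. \<chi> (\<mu> * root_fun P))"

lemma equiv_scaling_rel:
  "equiv (nonzero_vectors q :: ('a::field \<times> 'a) set) (scaling_rel q)"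
  (is "equiv ?V ?R")
proof (rule equivI)
  show "?R \<subseteq> ?V \<times> ?V"
    by (auto simp: scaling_rel_def)
  show "refl_on ?V ?R"
  proof (rule refl_onI)
    fix p assume "p \<in> ?V"
    moreover have "1 \<in> fixed_subfield q - {0 :: 'a}"
      by (simp add: fixed_subfield_def)
    ultimately show "(p, p) \<in> ?R"
      by (cases p) (force simp: scaling_rel_def)
  qed
  show "sym ?R"
  proof (rule symI)
    fix p p' :: "'a \<times> 'a"
    assume "(p, p') \<in> scaling_rel q"
    then obtain u w c where c: "c \<in> fixed_subfield q - {0}" "p = (u, w)" "p' = (c * u, c * w)"
        "p \<in> nonzero_vectors q" "p' \<in> nonzero_vectors q"
      by (auto simp: scaling_rel_def)
    have "inverse c \<in> fixed_subfield q - {0}"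
      using c(1) by (auto simp: fixed_subfield_def power_inverse)
    then show "(p', p) \<in> scaling_rel q"
      using c by (auto simp: scaling_rel_def intro!: bexI[of _ "inverse c"])
  qed
  show "trans ?R"
  proof (rule transI)
    fix p p' p'' :: "'a \<times> 'a"
    assume "(p, p') \<in> scaling_rel q" "(p', p'') \<in> scaling_rel q"
    then obtain u w c d where c: "c \<in> fixed_subfield q - {0}" "d \<in> fixed_subfield q - {0}"
        "p = (u, w)" "p'' = (d * (c * u), d * (c * w))"
        "p \<in> nonzero_vectors q" "p'' \<in> nonzero_vectors q"
      by (auto simp: scaling_rel_def)
    have "d * c \<in> fixed_subfield q - {0}"
      using c by (auto simp: fixed_subfield_def power_mult_distrib)
    then show "(p, p'') \<in> scaling_rel q"
      using c by (auto simp: scaling_rel_def mult.assoc intro!: bexI[of _ "d * c"])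
  qed
qed

lemma root_fun_proj_point:
  assumes "(u, w) \<in> nonzero_vectors q"
  shows "root_fun (proj_point q u w) = (w - u / 2) / u"
proof -
  let ?f = "\<lambda>(u, w). (w - u / 2) / u"
  have const: "?f p = (w - u / 2) / u" if "p \<in> proj_point q u w" for p
  proof -
    have "\<exists>c \<in> fixed_subfield q - {0}. fst p = c * u \<and> snd p = c * w"
      using that by (cases p) (simp add: proj_point_def scaling_rel_def)
    then obtain c where c: "c \<noteq> 0" "p = (c * u, c * w)"
      by (metis DiffE singletonI prod.collapse)
    have "c * w - c * u / 2 = c * (w - u / 2)"
      by (simp add: right_diff_distrib)
    then show ?thesis
      using c by simp
  qed
  have "(u, w) \<in> proj_point q u w"
    using equiv_class_self[OF equiv_scaling_rel assms] by (simp add: proj_point_def)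
  then have "proj_point q u w \<noteq> {}"
    by blast
  moreover have "?f ` proj_point q u w = (\<lambda>_. (w - u / 2) / u) ` proj_point q u w"
    by (rule image_cong[OF refl const])
  ultimately show ?thesis
    unfolding root_fun_def by (simp only: image_constant_conv if_False the_elem_eq)
qed

end

theory Submission
  imports Defs "HOL-Algebra.Algebraic_Closure_Type"
begin

text \<open>Why the bound holds. As the order of \<open>\<chi>\<close> divides \<open>q\<^sup>2 - 1\<close>, the character \<open>\<chi>\<close> is trivial on
the kernel of the norm \<open>w \<mapsto> w ^ (q\<^sup>2 + 1)\<close> from the field with \<open>q^4\<close> elements to the
one with \<open>q\<^sup>2\<close> elements, so it is a character \<open>\<psi>\<close> of the smaller field composed with
the norm (\<open>descend_character\<close>). On the conic one may take \<open>u = 1\<close>; then \<open>b = v - 1/2\<close> has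
norm \<open>1/4 - v\<^sup>2\<close>, and the equation of the conic says that \<open>v\<^sup>2 = t + \<Delta>/2\<close> with \<open>t\<close> in the
base field. A given \<open>t\<close> comes from \<open>1 - \<eta> (t + \<Delta>/2)\<close> vectors \<open>v\<close>, where \<open>\<eta>\<close> is the
quadratic character of the field with \<open>q\<^sup>2\<close> elements (\<open>conic_fibration\<close>). With
\<open>c = 1/4 - \<Delta>/2\<close> and \<open>e = - \<Delta>/2\<close> the conic sum is therefore, up to the factor \<open>\<chi> \<mu>\<close> of
modulus one, the difference \<open>T1 - T2\<close> of the sums over \<open>t\<close> in the base field of
\<open>\<psi> (c - t)\<close> and of \<open>\<psi> (c - t) * \<eta> (e - t)\<close>.

These two sums are the linear coefficients of the L-functions attached to the completely
multiplicative functions \<open>f \<mapsto> \<psi> (f(c))\<close> and \<open>f \<mapsto> \<psi> (f(c)) * \<eta> (f(e))\<close> of monic polynomials over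
the base field. Both are Dirichlet characters, one modulo the minimal polynomial of \<open>c\<close>, of degree
2, the other modulo the product of the minimal polynomials of \<open>c\<close> and \<open>e\<close>, of degree 4. So the
L-functions are polynomials of degree at most 1 and 3, and \<open>-T1\<close> and \<open>-T2\<close> are sums of at
most 1 and 3 inverse roots. Each inverse root has modulus at most \<open>sqrt q\<close>, which gives
\<open>4 * sqrt q\<close>. If \<open>d\<close> divides \<open>q + 1\<close>, then \<open>\<psi>\<close> is trivial on the base field, both L-functions
vanish at 1, and the inverse root 1 that they share cancels in \<open>T1 - T2\<close>: two inverse roots
remain.

The bound for the inverse roots is the Riemann hypothesis for these L-functions. Their power sums
of order \<open>n\<close> are, up to sign, the analogous character sums over the extension of degree \<open>n\<close>
(\<open>newton_identity\<close>, \<open>newton_power_sums\<close>), so an estimate of these sums by a constant times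
\<open>q ^ (n div 2)\<close> for all large multiples \<open>n\<close> of 4 suffices (\<open>power_sum_bound\<close>). The constant is
irrelevant, which makes an elementary proof possible. Adding the two sums replaces the factor
\<open>1 + \<eta>\<close> by a pull-back to the double cover \<open>s\<^sup>2 = (t - e) / (t - e ^ q)\<close>, and leaves the sum of
\<open>\<psi>\<close> over the norms of the values \<open>g(s)\<close> of one polynomial \<open>g\<close> of fixed degree with a
simple zero (\<open>combined_sum_bound\<close>). Such a sum is small as soon as no norm is taken too often.
That is shown by the method of Stepanov in Bombieri's form (\<open>level_set_bound\<close>): a
counting argument yields a nonzero polynomial of small degree that vanishes on the whole level set.

All extensions live inside the algebraic closure of the given field: \<open>GF n\<close> is its subfield with
\<open>q ^ n\<close> elements.\<close>

hide_const (open) Divisibility.prime Coset.order Polynomials.degree Polynomials.lead_coeff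
  Module.smult

section \<open>Roots of polynomials over an algebraically closed field\<close>

lemma proots_linear_factors: "proots (\<Prod>x\<in>#A. [:-x, 1:]) = (A :: 'k::idom multiset)"
proof (induction A)
  case (add x A)
  have "proots (\<Prod>x\<in>#add_mset x A. [:-x, 1:]) = proots ([:-x, 1:] * (\<Prod>x\<in>#A. [:-x, 1:]))" by simp
  also have "\<dots> = proots [:-x, 1:] + proots (\<Prod>x\<in>#A. [:-x, 1:])"
    by (rule proots_mult) (auto simp: prod_mset_zero_iff)
  finally show ?case using add by simp
qed simp

lemma sum_order_roots:
  fixes p :: "'k::alg_closed_field poly"
  assumes "p \<noteq> 0"
  shows "(\<Sum>x | poly p x = 0. order x p) = degree p"
proof -
  obtain A where A: "size A = degree p" "p = smult (lead_coeff p) (\<Prod>x\<in>#A. [:-x, 1:])"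
    using alg_closed_imp_factorization[OF assms] by blast
  have "proots p = A"
    by (subst A(2)) (use assms in \<open>simp add: proots_linear_factors\<close>)
  then have "size (proots p) = degree p" using A by simp
  then show ?thesis using assms by (simp add: size_multiset_overloaded_eq)
qed

lemma sum_if_card:
  "finite A \<Longrightarrow> (\<Sum>x\<in>A. if P x then c else 0) = of_nat (card {x \<in> A. P x}) * (c :: 'c::semiring_1)"
  by (simp flip: sum.inter_filter)

text \<open>This is how the orbit polynomials that divide a given polynomial are recognised below.\<close>

lemma dvd_if_order_le:
  fixes f g :: "'k::alg_closed_field poly"
  assumes "f \<noteq> 0" "g \<noteq> 0" "\<And>x. order x f \<le> order x g"
  shows "f dvd g"
proof -
  obtain A where A: "f = smult (lead_coeff f) (\<Prod>x\<in>#A. [:-x, 1:])"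
    using alg_closed_imp_factorization[OF assms(1)] by blast
  obtain B where B: "g = smult (lead_coeff g) (\<Prod>x\<in>#B. [:-x, 1:])"
    using alg_closed_imp_factorization[OF assms(2)] by blast
  have "proots f = A" "proots g = B"
    by (subst A, use assms in \<open>simp add: proots_linear_factors\<close>) (subst B, use assms in \<open>simp add: proots_linear_factors\<close>)
  then have "A \<subseteq># B" using assms by (metis count_proots mset_subset_eqI)
  then obtain C where "B = A + C" by (metis subset_mset.add_diff_inverse)
  then have "(\<Prod>x\<in>#A. [:-x, 1:]) dvd (\<Prod>x\<in>#B. [:-x, 1:])" by simp
  then show ?thesis
    using assms(1,2) by (subst A, subst B) (simp add: smult_dvd_iff dvd_smult)
qed

section \<open>Finite subfields and the Frobenius map\<close>

text \<open>All finite extensions of the field with \<open>q\<close> elements are subfields of one algebraically closed field, so that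
points of different degrees over the base field are elements of one type.\<close>

locale frobenius_closure =
  fixes q :: nat and ty :: "'k::alg_closed_field itself"
  assumes char_prime: "prime CHAR('k)" and q_power: "\<exists>r>0. q = CHAR('k) ^ r"
begin

lemma q_gt_1: "q > 1"
  using q_power char_prime by (metis prime_gt_1_nat one_less_power)

lemma q_pow_char: "\<exists>s. q ^ n = CHAR('k) ^ s"
  using q_power by (metis power_mult)

lemma frob_add: "(x + y :: 'k) ^ (q ^ n) = x ^ (q ^ n) + y ^ (q ^ n)"
  using q_pow_char[of n] freshmans_dream'[OF char_prime] by blast

lemma frob_0: "(0::'k) ^ (q ^ n) = 0"
  using q_gt_1 by simp

lemma frob_minus: "(- x :: 'k) ^ (q ^ n) = - (x ^ (q ^ n))"
  using frob_add[of x "-x" n] frob_0[of n] by (simp add: eq_neg_iff_add_eq_0 add.commute)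

lemma frob_diff: "(x - y :: 'k) ^ (q ^ n) = x ^ (q ^ n) - y ^ (q ^ n)"
  using frob_add[of x "-y" n] frob_minus[of y n] by simp

lemma frob_sum: "(\<Sum>i\<in>A. f i :: 'k) ^ (q ^ n) = (\<Sum>i\<in>A. f i ^ (q ^ n))"
  using q_pow_char[of n] freshmans_dream_sum'[OF char_prime] by blast

lemma frob_inj: "(x :: 'k) ^ (q ^ n) = y ^ (q ^ n) \<longleftrightarrow> x = y"
  using frob_diff[of x y n] by auto

lemma frob_surj: "\<exists>y :: 'k. y ^ (q ^ n) = x"
  using nth_root_exists[of "q ^ n" x] q_gt_1 by simp

definition GF :: "nat \<Rightarrow> 'k set" where
  "GF n = fixed_subfield (q ^ n)"

lemma GF_iff: "x \<in> GF n \<longleftrightarrow> x ^ (q ^ n) = x" by (simp add: GF_def fixed_subfield_def)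

lemma GF_0 [simp]: "0 \<in> GF n" by (simp add: GF_iff frob_0)
lemma GF_1 [simp]: "1 \<in> GF n" by (simp add: GF_iff)
lemma GF_add: "x \<in> GF n \<Longrightarrow> y \<in> GF n \<Longrightarrow> x + y \<in> GF n" by (simp add: GF_iff frob_add)
lemma GF_diff: "x \<in> GF n \<Longrightarrow> y \<in> GF n \<Longrightarrow> x - y \<in> GF n" by (simp add: GF_iff frob_diff)
lemma GF_minus: "x \<in> GF n \<Longrightarrow> - x \<in> GF n" by (simp add: GF_iff frob_minus)
lemma GF_mult: "x \<in> GF n \<Longrightarrow> y \<in> GF n \<Longrightarrow> x * y \<in> GF n" by (simp add: GF_iff power_mult_distrib)
lemma GF_divide: "x \<in> GF n \<Longrightarrow> y \<in> GF n \<Longrightarrow> x / y \<in> GF n" by (simp add: GF_iff power_divide)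
lemma GF_power: "x \<in> GF n \<Longrightarrow> x ^ k \<in> GF n"
  by (induction k) (auto intro: GF_mult)
lemma GF_sum: "(\<And>i. i \<in> A \<Longrightarrow> f i \<in> GF n) \<Longrightarrow> (\<Sum>i\<in>A. f i) \<in> GF n"
  by (induction A rule: infinite_finite_induct) (auto intro: GF_add)

lemma frob_frob: "(x ^ (q ^ m)) ^ (q ^ n) = (x::'k) ^ (q ^ (m + n))"
  by (simp add: power_add power_mult)

lemma GF_frob_mult: "x \<in> GF n \<Longrightarrow> x ^ (q ^ (n * k)) = x"
proof (induction k)
  case (Suc k)
  then show ?case using frob_frob[of x "n * k" n] by (simp add: GF_iff add.commute)
qed simp

lemma GF_mono: "m dvd n \<Longrightarrow> GF m \<subseteq> GF n"
  using GF_frob_mult by (auto elim!: dvdE simp: GF_iff)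

text \<open>The derivative of \<open>X ^ (q ^ n) - X\<close> is the constant \<open>-1\<close>, so this polynomial has no multiple
root and hence exactly \<open>q ^ n\<close> roots.\<close>

lemma finite_card_GF:
  assumes "n > 0" shows "finite (GF n)" "card (GF n) = q ^ n"
proof -
  let ?p = "monom 1 (q ^ n) - monom 1 1 :: 'k poly"
  have 1: "1 < q ^ n" using one_less_power[OF q_gt_1 assms] .
  have deg: "degree ?p = q ^ n"
    using degree_add_eq_left[of "- monom 1 1" "monom 1 (q ^ n) :: 'k poly"] 1 by (simp add: degree_monom_eq)
  have nz: "?p \<noteq> 0" using deg 1 by (metis degree_0 not_one_less_zero)
  have roots: "{x. poly ?p x = 0} = GF n"
    by (auto simp: GF_iff poly_monom)
  obtain r where r: "r > 0" "q = CHAR('k) ^ r" using q_power by auto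
  have "CHAR('k) dvd CHAR('k) ^ (r * n)" by (rule dvd_power) (use r assms in auto)
  then have "CHAR('k) dvd q ^ n" by (simp only: r(2) power_mult)
  then have "of_nat (q ^ n) = (0::'k)" using of_nat_eq_0_iff_char_dvd by blast
  then have pd: "poly (pderiv ?p) a = -1" for a
    by (simp add: pderiv_diff pderiv_monom poly_monom)
  have ord: "order a ?p = 1" if a: "poly ?p a = 0" for a
  proof -
    obtain g where g: "?p = [:-a, 1:] * g" using a by (meson poly_eq_0_iff_dvd dvdE)
    have "poly (pderiv ?p) a = poly g a" unfolding g
      by (simp add: pderiv_mult pderiv_pCons del: mult_pCons_left)
    then have ga: "poly g a \<noteq> 0" using pd[of a] by (metis neg_equal_0_iff_equal zero_neq_one)
    have "order a ?p = order a [:-a, 1:] + order a g"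
      unfolding g by (rule order_mult) (use g nz in metis)
    then show ?thesis using order_power_n_n[of a 1] order_0I[OF ga] by simp
  qed
  have "(\<Sum>x\<in>GF n. order x ?p) = q ^ n"
    using sum_order_roots[OF nz] deg roots by simp
  moreover have "(\<Sum>x\<in>GF n. order x ?p) = (\<Sum>x\<in>GF n. 1)"
    by (rule sum.cong) (use roots ord in auto)
  ultimately show "card (GF n) = q ^ n" by simp
  show "finite (GF n)" using poly_roots_finite[OF nz] roots by simp
qed

lemma infinite_UNIV_closure: "infinite (UNIV :: 'k set)"
proof
  assume fin: "finite (UNIV :: 'k set)"
  define n where "n = Suc (card (UNIV :: 'k set))"
  have "q ^ n \<le> card (UNIV :: 'k set)"
    using finite_card_GF[of n] card_mono[OF fin, of "GF n"] by (simp add: n_def)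
  moreover have "n < q ^ n" using q_gt_1 by (simp add: power_gt_expt)
  ultimately show False by (simp add: n_def)
qed

lemma poly_ext:
  assumes "\<And>x. poly f x = poly (g :: 'k poly) x" shows "f = g"
proof (rule ccontr)
  assume "f \<noteq> g"
  then have "finite {x. poly (f - g) x = 0}" by (intro poly_roots_finite) simp
  then show False using assms infinite_UNIV_closure by simp
qed

definition frob_poly :: "'k poly \<Rightarrow> 'k poly" where
  "frob_poly = map_poly (\<lambda>x. x ^ q)"

definition base_poly :: "'k poly \<Rightarrow> bool" where
  "base_poly f \<longleftrightarrow> (\<forall>i. coeff f i \<in> GF 1)"

lemma coeff_frob_poly: "coeff (frob_poly f) i = coeff f i ^ q"
  unfolding frob_poly_def using frob_0[of 1] by (subst coeff_map_poly) auto

lemma base_poly_iff: "base_poly f \<longleftrightarrow> frob_poly f = f"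
  by (auto simp: base_poly_def poly_eq_iff coeff_frob_poly GF_iff)

lemma degree_frob_poly: "degree (frob_poly f) = degree f"
  unfolding frob_poly_def by (rule degree_map_poly) simp

lemma poly_frob_poly: "poly (frob_poly f) (x ^ q) = poly f x ^ q"
proof -
  have "poly f x ^ (q^1) = (\<Sum>i\<le>degree f. (coeff f i * x ^ i) ^ (q^1))"
    unfolding poly_altdef by (rule frob_sum)
  then show ?thesis
    by (simp add: poly_altdef degree_frob_poly coeff_frob_poly power_mult_distrib mult.commute flip: power_mult)
qed

text \<open>As the Frobenius map is surjective and the field is infinite, the conjugate polynomial is determined by
its values at \<open>q\<close>-th powers. All algebraic properties of conjugation follow from this criterion.\<close>

lemma frob_poly_eqI:
  assumes "\<And>x. poly g (x ^ q) = poly f x ^ q" shows "frob_poly f = g"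
proof (rule poly_ext)
  fix x :: 'k
  obtain y where "y ^ q = x" using frob_surj[of 1 x] by auto
  then show "poly (frob_poly f) x = poly g x" using assms[of y] poly_frob_poly[of f y] by auto
qed

lemma frob_poly_mult: "frob_poly (f * g) = frob_poly f * frob_poly g"
  by (rule frob_poly_eqI) (simp add: poly_frob_poly power_mult_distrib)

lemma frob_poly_linear: "frob_poly [:-a, 1:] = [:-(a ^ q), 1:]"
  by (rule frob_poly_eqI) (use frob_diff[of _ a 1] in simp)

lemma frob_poly_1: "frob_poly 1 = 1"
  by (rule frob_poly_eqI) simp

lemma frob_poly_prod: "frob_poly (\<Prod>i\<in>A. f i) = (\<Prod>i\<in>A. frob_poly (f i))"
  by (induction A rule: infinite_finite_induct) (auto simp: frob_poly_mult frob_poly_1)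

lemma frob_poly_power: "frob_poly (f ^ n) = frob_poly f ^ n"
  by (induction n) (auto simp: frob_poly_mult frob_poly_1)

lemma base_poly_mult: "base_poly f \<Longrightarrow> base_poly g \<Longrightarrow> base_poly (f * g)"
  by (simp add: base_poly_iff frob_poly_mult)

lemma base_poly_cofactor:
  assumes "base_poly (f * g)" "base_poly f" "f \<noteq> 0" shows "base_poly g"
  using assms by (simp add: base_poly_iff frob_poly_mult)

lemma poly_base_frob:
  assumes "base_poly f" shows "poly f (x ^ (q ^ n)) = poly f x ^ (q ^ n)"
proof (induction n)
  case (Suc n)
  have "poly f (x ^ (q ^ Suc n)) = poly f ((x ^ (q ^ n)) ^ q)"
    using frob_frob[of x n 1] by simp
  also have "\<dots> = poly f (x ^ (q ^ n)) ^ q"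
    using poly_frob_poly[of f] assms by (metis base_poly_iff)
  finally show ?case using Suc frob_frob[of "poly f x" n 1] by simp
qed simp

lemma poly_base_GF: "base_poly f \<Longrightarrow> x \<in> GF n \<Longrightarrow> poly f x \<in> GF n"
  using poly_base_frob[of f x n] by (simp add: GF_iff)

text \<open>Conjugation fixes \<open>f\<close> and moves the factors \<open>X - x\<close> to \<open>X - x ^ q\<close>.\<close>

lemma order_base_frob:
  assumes "base_poly f" "f \<noteq> 0" shows "order (x ^ (q ^ n)) f = order x f"
proof -
  have step: "order (y ^ q) f = order y f" for y
  proof -
    define k where "k = order y f"
    obtain g where g: "f = [:-y, 1:] ^ k * g" using order_1[of y f] by (auto simp: k_def elim: dvdE)
    have "poly g y \<noteq> 0"
    proof
      assume "poly g y = 0"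
      then obtain h where "g = [:-y, 1:] * h" by (meson poly_eq_0_iff_dvd dvdE)
      then have "f = [:-y, 1:] ^ Suc k * h" using g by (simp only: power_Suc2 mult.assoc)
      then have "[:-y, 1:] ^ Suc k dvd f" by (rule dvdI)
      then show False using order[OF assms(2), of y] by (simp add: k_def)
    qed
    then have nz: "poly (frob_poly g) (y ^ q) \<noteq> 0" using q_gt_1 by (simp add: poly_frob_poly)
    have f: "f = [:-(y ^ q), 1:] ^ k * frob_poly g"
      using assms(1) g frob_poly_mult[of "[:-y, 1:] ^ k" g]
      by (simp add: base_poly_iff frob_poly_power frob_poly_linear)
    have "order (y ^ q) f = order (y ^ q) ([:-(y ^ q), 1:] ^ k) + order (y ^ q) (frob_poly g)"
      by (subst f, rule order_mult) (use f assms(2) in metis)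
    then show ?thesis using order_power_n_n[of "y ^ q" k] order_0I[OF nz] by (simp add: k_def)
  qed
  show ?thesis
  proof (induction n)
    case (Suc n)
    then show ?case using step[of "x ^ (q ^ n)"] frob_frob[of x n 1] by simp
  qed simp
qed

end

section \<open>Monic polynomials over the base field and the Newton identity\<close>

context frobenius_closure
begin

definition monics :: "nat \<Rightarrow> 'k poly set" where
  "monics n = {f. base_poly f \<and> degree f = n \<and> lead_coeff f = 1}"

definition polys_below :: "nat \<Rightarrow> 'k poly set" where
  "polys_below n = {f. base_poly f \<and> (\<forall>i\<ge>n. coeff f i = 0)}"

lemma GF1_finite: "finite (GF 1)" and GF1_card: "card (GF 1) = q"
  using finite_card_GF[of 1] by auto

lemma bij_polys_below: "bij_betw (\<lambda>c. \<Sum>i<n. monom (c i) i) ({..<n} \<rightarrow>\<^sub>E GF 1) (polys_below n)"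
proof (rule bij_betwI[where g = "\<lambda>f. restrict (coeff f) {..<n}"])
  show "(\<lambda>c. \<Sum>i<n. monom (c i) i) \<in> ({..<n} \<rightarrow>\<^sub>E GF 1) \<rightarrow> polys_below n"
    by (auto simp: polys_below_def base_poly_def coeff_sum PiE_def Pi_def if_distrib sum.delta' cong: if_cong)
  show "(\<lambda>f. restrict (coeff f) {..<n}) \<in> polys_below n \<rightarrow> {..<n} \<rightarrow>\<^sub>E GF 1"
    by (auto simp: polys_below_def base_poly_def)
  show "restrict (coeff (\<Sum>i<n. monom (c i) i)) {..<n} = c" if "c \<in> {..<n} \<rightarrow>\<^sub>E GF 1" for c
    using that by (auto simp: fun_eq_iff coeff_sum PiE_def extensional_def restrict_def sum.delta')
  show "(\<Sum>i<n. monom (restrict (coeff f) {..<n} i) i) = f" if "f \<in> polys_below n" for f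
    using that by (auto simp: poly_eq_iff coeff_sum polys_below_def sum.delta' not_less)
qed

lemma finite_polys_below: "finite (polys_below n)" and card_polys_below: "card (polys_below n) = q ^ n"
proof -
  show "finite (polys_below n)"
    using bij_betw_finite[OF bij_polys_below] finite_PiE[of "{..<n}" "\<lambda>_. GF 1"] GF1_finite by auto
  show "card (polys_below n) = q ^ n"
    using bij_betw_same_card[OF bij_polys_below[of n]] by (simp add: card_PiE GF1_card[simplified])
qed

text \<open>Splitting off the \<open>M\<close> lowest coefficients. It lets a sum over monic polynomials run freely over
their lower part, on which evaluation at a few points is a bijection.\<close>

lemma bij_monics_split:
  "bij_betw (\<lambda>(h, r). monom 1 M * h + r) (monics n \<times> polys_below M) (monics (M + n))"
proof -
  have co: "coeff (monom 1 M * h + r) i = (if i < M then coeff r i else coeff h (i - M))"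
    if "r \<in> polys_below M" for h r i
    using that by (auto simp: coeff_monom_mult polys_below_def)
  show ?thesis
  proof (rule bij_betwI[where g = "\<lambda>f. (poly_shift M f, poly_cutoff M f)"])
    show "(\<lambda>(h, r). monom 1 M * h + r) \<in> monics n \<times> polys_below M \<rightarrow> monics (M + n)"
    proof safe
      fix h r assume h: "h \<in> monics n" and r: "r \<in> polys_below M"
      have "degree (monom 1 M * h + r) = M + n"
      proof (rule antisym)
        show "degree (monom 1 M * h + r) \<le> M + n"
          by (intro degree_le allI impI, unfold co[OF r]) (use h in \<open>auto simp: monics_def coeff_eq_0\<close>)
        show "degree (monom 1 M * h + r) \<ge> M + n"
          by (rule le_degree, unfold co[OF r]) (use h in \<open>auto simp: monics_def\<close>)
      qed
      then show "monom 1 M * h + r \<in> monics (M + n)"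
        unfolding monics_def base_poly_def mem_Collect_eq co[OF r]
        using h r by (auto simp: monics_def polys_below_def base_poly_def)
    qed
    show "(\<lambda>f. (poly_shift M f, poly_cutoff M f)) \<in> monics (M + n) \<rightarrow> monics n \<times> polys_below M"
    proof safe
      fix f assume f: "f \<in> monics (M + n)"
      have "degree (poly_shift M f) = n"
      proof (rule antisym)
        show "degree (poly_shift M f) \<le> n"
          by (rule degree_le) (use f in \<open>auto simp: coeff_poly_shift monics_def coeff_eq_0\<close>)
        show "degree (poly_shift M f) \<ge> n"
          by (rule le_degree) (use f in \<open>auto simp: coeff_poly_shift monics_def add.commute\<close>)
      qed
      then show "poly_shift M f \<in> monics n"
        using f by (auto simp: monics_def coeff_poly_shift base_poly_def add.commute)
      show "poly_cutoff M f \<in> polys_below M"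
        using f by (auto simp: monics_def coeff_poly_cutoff base_poly_def polys_below_def)
    qed
    show "(\<lambda>f. (poly_shift M f, poly_cutoff M f)) ((\<lambda>(h, r). monom 1 M * h + r) p) = p"
      if "p \<in> monics n \<times> polys_below M" for p
    proof -
      obtain h r where p: "p = (h, r)" by (cases p)
      then have r: "r \<in> polys_below M" using that by simp
      have "poly_shift M (monom 1 M * h + r) = h" "poly_cutoff M (monom 1 M * h + r) = r"
        unfolding poly_eq_iff coeff_poly_shift coeff_poly_cutoff co[OF r]
        using r by (auto simp: polys_below_def)
      then show ?thesis by (simp add: p)
    qed
    show "(\<lambda>(h, r). monom 1 M * h + r) ((\<lambda>f. (poly_shift M f, poly_cutoff M f)) f) = f" if "f \<in> monics (M + n)" for f
      by (auto simp: poly_eq_iff coeff_monom_mult coeff_poly_shift coeff_poly_cutoff)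
  qed
qed

lemma monics_0: "monics 0 = {1}"
  by (auto simp: monics_def base_poly_def elim!: degree_eq_zeroE)

lemma finite_monics: "finite (monics n)"
proof -
  have "finite (monics 0 \<times> polys_below n)" using finite_polys_below by (simp add: monics_0)
  then show ?thesis using bij_betw_finite[OF bij_monics_split[of n 0]] by simp
qed

text \<open>For \<open>t\<close> in \<open>GF m\<close> this is the norm of \<open>X - t\<close> to the polynomials over the base field, that
is, the power of the minimal polynomial of \<open>t\<close> that has degree \<open>m\<close>.\<close>

definition orbit_poly :: "nat \<Rightarrow> 'k \<Rightarrow> 'k poly" where
  "orbit_poly m t = (\<Prod>i<m. [:-(t ^ (q ^ i)), 1:])"

lemma orbit_poly_monic: "degree (orbit_poly m t) = m" "lead_coeff (orbit_poly m t) = 1"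
proof -
  show "degree (orbit_poly m t) = m"
    unfolding orbit_poly_def by (subst degree_prod_eq_sum_degree) auto
  show "lead_coeff (orbit_poly m t) = 1"
    unfolding orbit_poly_def by (simp add: lead_coeff_prod)
qed

text \<open>Conjugation shifts the factors cyclically, because \<open>t ^ (q ^ m) = t\<close>.\<close>

lemma orbit_poly_base:
  assumes "t \<in> GF m" shows "base_poly (orbit_poly m t)"
proof -
  have "frob_poly (orbit_poly m t) = (\<Prod>i<m. [:-(t ^ (q ^ Suc i)), 1:])"
    unfolding orbit_poly_def frob_poly_prod frob_poly_linear
    by (simp add: mult.commute flip: power_mult)
  also have "\<dots> = (\<Prod>i<m. [:-(t ^ (q ^ i)), 1:])"
  proof (cases m)
    case (Suc k)
    have "(\<Prod>i<Suc k. [:-(t ^ (q ^ Suc i)), 1:]) = (\<Prod>i<k. [:-(t ^ (q ^ Suc i)), 1:]) * [:-t, 1:]"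
      using assms Suc by (simp add: GF_iff mult.commute)
    then show ?thesis unfolding Suc by (subst (2) prod.lessThan_Suc_shift) (simp add: mult.commute)
  qed simp
  finally show ?thesis by (simp add: base_poly_iff orbit_poly_def)
qed

lemma order_orbit_poly: "order x (orbit_poly m t) = card {i. i < m \<and> t ^ (q ^ i) = x}"
proof -
  have "order x (orbit_poly m t) = count (proots (orbit_poly m t)) x"
    by (subst count_proots) (use orbit_poly_monic[of m t] in auto)
  also have "proots (orbit_poly m t) = (\<Sum>i<m. {# t ^ (q ^ i) #})"
    unfolding orbit_poly_def by (subst proots_prod) auto
  also have "count \<dots> x = (\<Sum>i<m. if t ^ (q ^ i) = x then 1 else 0)"
    by (simp add: count_sum cong: if_cong)
  also have "\<dots> = card {i. i < m \<and> t ^ (q ^ i) = x}"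
    by (subst sum.If_cases) (auto intro!: arg_cong[of _ _ card])
  finally show ?thesis .
qed

text \<open>If \<open>d\<close> is the degree of \<open>t\<close> over the base field, then \<open>t\<close> lies in \<open>GF m\<close> exactly for the
multiples \<open>m = d * k\<close>, and the orbit polynomial is then the \<open>k\<close>-th power of the minimal polynomial.
It divides \<open>f\<close> exactly for \<open>k\<close> up to the multiplicity of \<open>t\<close> in \<open>f\<close>.\<close>

lemma count_orbit_polys_at_root:
  assumes f: "f \<in> monics n" and t: "poly f t = 0"
  shows "card {m \<in> {1..n}. t \<in> GF m \<and> orbit_poly m t dvd f} = order t f"
proof -
  have f0: "f \<noteq> 0" and base: "base_poly f" and deg: "degree f = n"
    using f by (auto simp: monics_def)
  have fin: "finite {x. poly f x = 0}" using poly_roots_finite[OF f0] .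
  have "(\<lambda>i. t ^ (q ^ i)) ` UNIV \<subseteq> {x. poly f x = 0}"
    using poly_base_frob[OF base, of t] t by (auto simp: frob_0)
  then have "finite ((\<lambda>i. t ^ (q ^ i)) ` UNIV)" using fin finite_subset by blast
  then have "\<not> inj (\<lambda>i. t ^ (q ^ i))" using finite_imageD by blast
  then obtain i j where "t ^ (q ^ i) = t ^ (q ^ j)" "i < j"
    unfolding inj_def by (metis linorder_neqE_nat)
  then have "(t ^ (q ^ (j - i))) ^ (q ^ i) = t ^ (q ^ i)" using frob_frob[of t "j - i" i] by simp
  then have ex: "\<exists>k. k > 0 \<and> t \<in> GF k" using frob_inj \<open>i < j\<close> by (auto simp: GF_iff intro!: exI[of _ "j - i"])
  define d where "d = (LEAST k. k > 0 \<and> t \<in> GF k)"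
  have d: "d > 0" "t \<in> GF d" using LeastI_ex[OF ex] by (auto simp: d_def)
  have mem: "t \<in> GF m \<longleftrightarrow> d dvd m" for m
  proof
    assume tm: "t \<in> GF m"
    have "t ^ (q ^ (d * (m div d) + m mod d)) = t ^ (q ^ (m mod d))"
      using frob_frob[of t "d * (m div d)" "m mod d"] GF_frob_mult[OF d(2)] by metis
    then have "t \<in> GF (m mod d)" using tm by (simp add: GF_iff)
    then have "\<not> m mod d > 0" using not_less_Least[of "m mod d" "\<lambda>k. k > 0 \<and> t \<in> GF k"] d(1)
      by (auto simp: d_def[symmetric])
    then show "d dvd m" by auto
  qed (use GF_mono d in blast)
  have ord: "order t (orbit_poly (d * k) t) = k" for k
  proof -
    have "{i. i < d * k \<and> t ^ (q ^ i) = t} = (*) d ` {..<k}"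
      using d mem by (auto simp: GF_iff elim!: dvdE)
    then show ?thesis using d by (simp add: order_orbit_poly card_image inj_on_def)
  qed
  have dvd: "orbit_poly (d * k) t dvd f \<longleftrightarrow> k \<le> order t f" for k
  proof
    assume "orbit_poly (d * k) t dvd f"
    then show "k \<le> order t f" using dvd_imp_order_le[OF f0] ord by metis
  next
    assume k: "k \<le> order t f"
    have tm: "t \<in> GF (d * k)" using mem by simp
    have nz: "orbit_poly (d * k) t \<noteq> 0" using orbit_poly_monic[of "d * k" t] by auto
    show "orbit_poly (d * k) t dvd f"
    proof (rule dvd_if_order_le[OF nz f0])
      fix x show "order x (orbit_poly (d * k) t) \<le> order x f"
      proof (cases "\<exists>i. t ^ (q ^ i) = x")
        case True
        then obtain i where i: "x = t ^ (q ^ i)" by auto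
        show ?thesis unfolding i using k ord
          order_base_frob[OF base f0] order_base_frob[OF orbit_poly_base[OF tm] nz] by simp
      qed (auto simp: order_orbit_poly)
    qed
  qed
  have "{m \<in> {1..n}. t \<in> GF m \<and> orbit_poly m t dvd f} = (*) d ` {1..order t f}"
  proof (intro equalityI subsetI)
    fix m assume "m \<in> {m \<in> {1..n}. t \<in> GF m \<and> orbit_poly m t dvd f}"
    then have m: "1 \<le> m" "d dvd m" "orbit_poly m t dvd f" using mem by auto
    then obtain k where k: "m = d * k" by (auto elim: dvdE)
    have "k \<ge> 1" using m(1) k by (cases k) auto
    moreover have "k \<le> order t f" using m(3) dvd[of k] k by simp
    ultimately have "k \<in> {1..order t f}" by simp
    then show "m \<in> (*) d ` {1..order t f}" unfolding k by (rule imageI)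
  next
    fix m assume "m \<in> (*) d ` {1..order t f}"
    then obtain k where "m = d * k" "k \<in> {1..order t f}" by blast
    then have k: "m = d * k" "1 \<le> k" "k \<le> order t f" by simp_all
    then have *: "orbit_poly m t dvd f" using dvd by simp
    have "m \<le> n" using dvd_imp_degree_le[OF * f0] deg orbit_poly_monic[of m t] by simp
    then show "m \<in> {m \<in> {1..n}. t \<in> GF m \<and> orbit_poly m t dvd f}"
      using * k d(1) mem[of m] by auto
  qed
  then show ?thesis using d(1) by (simp add: card_image inj_on_def)
qed

text \<open>Summing the multiplicities of all roots. This is the form in which unique factorisation enters: it
replaces the Euler product of an L-function.\<close>

lemma count_orbit_polys:
  assumes f: "f \<in> monics n"
  shows "(\<Sum>m=1..n. card {t \<in> GF m. orbit_poly m t dvd f}) = n"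
proof -
  have f0: "f \<noteq> 0" and deg: "degree f = n" using f by (auto simp: monics_def)
  have fin: "finite {x. poly f x = 0}" using poly_roots_finite[OF f0] .
  have root: "poly f t = 0" if "orbit_poly m t dvd f" "m \<ge> 1" for m t
  proof -
    have "0 \<in> {i. i < m \<and> t ^ (q ^ i) = t}" using that(2) by simp
    moreover have "finite {i. i < m \<and> t ^ (q ^ i) = t}" by simp
    ultimately have "order t (orbit_poly m t) \<noteq> 0" unfolding order_orbit_poly using card_gt_0_iff by fastforce
    then have "order t f \<noteq> 0" using dvd_imp_order_le[OF f0 that(1), of t] by simp
    then show ?thesis using order_root by blast
  qed
  let ?P = "\<lambda>m t. t \<in> GF m \<and> orbit_poly m t dvd f"
  let ?R = "{t. poly f t = 0}"
  have "(\<Sum>m=1..n. card {t \<in> GF m. orbit_poly m t dvd f})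
      = (\<Sum>m=1..n. \<Sum>t\<in>?R. if ?P m t then 1 else 0)"
  proof (rule sum.cong)
    fix m assume "m \<in> {1..n}"
    then have "{t \<in> GF m. orbit_poly m t dvd f} = {t \<in> ?R. ?P m t}" using root[of m] by auto
    then show "card {t \<in> GF m. orbit_poly m t dvd f} = (\<Sum>t\<in>?R. if ?P m t then 1 else 0)"
      using sum_if_card[OF fin, of "?P m" "1::nat"] by simp
  qed simp
  also have "\<dots> = (\<Sum>t\<in>?R. \<Sum>m=1..n. if ?P m t then 1 else 0)"
    by (rule sum.swap)
  also have "\<dots> = (\<Sum>t\<in>?R. order t f)"
  proof (rule sum.cong)
    fix t assume "t \<in> ?R"
    then show "(\<Sum>m=1..n. if ?P m t then 1 else 0) = order t f"
      using sum_if_card[of "{1..n}" "\<lambda>m. ?P m t" "1::nat"] count_orbit_polys_at_root[OF f, of t] by simp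
  qed simp
  finally show ?thesis using sum_order_roots[OF f0] deg by simp
qed

text \<open>The coefficient form of \<open>T L'(T) = L(T) * S(T)\<close>, where \<open>L\<close> is the L-function of \<open>\<Lambda>\<close> and \<open>S\<close> is the
series of its character sums over the extension fields. Each monic \<open>f\<close> of degree \<open>n\<close> is counted
\<open>n\<close> times, once for each pair of a degree \<open>m\<close> and an element \<open>t\<close> of \<open>GF m\<close> whose orbit polynomial divides
\<open>f\<close>, and \<open>\<Lambda>\<close> is multiplicative on the resulting factorisations.\<close>

lemma newton_identity:
  fixes \<Lambda> :: "'k poly \<Rightarrow> complex"
  assumes mult: "\<And>f g. base_poly f \<Longrightarrow> base_poly g \<Longrightarrow> \<Lambda> (f * g) = \<Lambda> f * \<Lambda> g"
  shows "of_nat n * (\<Sum>f\<in>monics n. \<Lambda> f)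
       = (\<Sum>m=1..n. (\<Sum>t\<in>GF m. \<Lambda> (orbit_poly m t)) * (\<Sum>f\<in>monics (n - m). \<Lambda> f))"
proof -
  have finGF: "finite (GF m)" if "m \<ge> 1" for m using finite_card_GF(1)[of m] that by simp
  have mb: "f \<in> monics k \<Longrightarrow> base_poly f" for f k by (simp add: monics_def)
  let ?c = "\<lambda>m t f. if orbit_poly m t dvd f then \<Lambda> f else 0"
  have "of_nat n * (\<Sum>f\<in>monics n. \<Lambda> f) = (\<Sum>f\<in>monics n. \<Sum>m=1..n. \<Sum>t\<in>GF m. ?c m t f)"
    unfolding sum_distrib_left
  proof (rule sum.cong)
    fix f assume f: "f \<in> monics n"
    have "of_nat n * \<Lambda> f = of_nat (\<Sum>m=1..n. card {t \<in> GF m. orbit_poly m t dvd f}) * \<Lambda> f"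
      by (simp only: count_orbit_polys[OF f])
    also have "\<dots> = (\<Sum>m=1..n. of_nat (card {t \<in> GF m. orbit_poly m t dvd f}) * \<Lambda> f)"
      by (simp only: of_nat_sum sum_distrib_right)
    also have "\<dots> = (\<Sum>m=1..n. \<Sum>t\<in>GF m. ?c m t f)"
      by (rule sum.cong[OF refl], rule sum_if_card[symmetric]) (use finGF in simp)
    finally show "of_nat n * \<Lambda> f = (\<Sum>m=1..n. \<Sum>t\<in>GF m. ?c m t f)" .
  qed simp
  also have "\<dots> = (\<Sum>m=1..n. \<Sum>f\<in>monics n. \<Sum>t\<in>GF m. ?c m t f)"
    by (rule sum.swap)
  also have "\<dots> = (\<Sum>m=1..n. \<Sum>t\<in>GF m. \<Sum>f\<in>monics n. ?c m t f)"
    by (rule sum.cong[OF refl], rule sum.swap)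
  also have "\<dots> = (\<Sum>m=1..n. \<Sum>t\<in>GF m. \<Lambda> (orbit_poly m t) * (\<Sum>f\<in>monics (n - m). \<Lambda> f))"
  proof (intro sum.cong refl)
    fix m t assume m: "m \<in> {1..n}" and t: "t \<in> GF m"
    let ?N = "orbit_poly m t"
    have N: "base_poly ?N" "degree ?N = m" "lead_coeff ?N = 1" "?N \<noteq> 0"
      using orbit_poly_base[OF t] orbit_poly_monic[of m t] by auto
    have bij: "bij_betw ((*) ?N) (monics (n - m)) {f \<in> monics n. ?N dvd f}"
    proof (rule bij_betwI')
      show "?N * f = ?N * g \<longleftrightarrow> f = g" for f g using N by simp
      show "?N * f \<in> {f \<in> monics n. ?N dvd f}" if "f \<in> monics (n - m)" for f
      proof -
        have "f \<noteq> 0" using that by (auto simp: monics_def)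
        then have "degree (?N * f) = n" using that N m degree_mult_eq[of ?N f] by (auto simp: monics_def)
        moreover have "lead_coeff (?N * f) = 1"
          using that N lead_coeff_mult[of ?N f] by (auto simp only: monics_def mem_Collect_eq mult_1)
        moreover have "base_poly (?N * f)" using that N base_poly_mult by (auto simp: monics_def)
        ultimately show ?thesis by (auto simp only: monics_def mem_Collect_eq dvd_triv_left)
      qed
      fix f assume f: "f \<in> {f \<in> monics n. ?N dvd f}"
      then obtain g where g: "f = ?N * g" by (auto elim: dvdE)
      have "g \<noteq> 0" using f g by (auto simp: monics_def)
      then have "degree g = n - m"
        using f N degree_mult_eq[of ?N g] by (auto simp: monics_def g)
      moreover have "lead_coeff g = 1"
        using f N lead_coeff_mult[of ?N g] by (auto simp only: monics_def g mem_Collect_eq mult_1)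
      moreover have "base_poly g" using f N base_poly_cofactor[of ?N g] by (auto simp: monics_def g)
      ultimately show "\<exists>g\<in>monics (n - m). f = ?N * g" using g by (auto simp: monics_def)
    qed
    have "(\<Sum>f\<in>monics n. if ?N dvd f then \<Lambda> f else 0) = (\<Sum>f | f \<in> monics n \<and> ?N dvd f. \<Lambda> f)"
      by (simp add: sum.If_cases finite_monics Int_def)
    also have "\<dots> = (\<Sum>g\<in>monics (n - m). \<Lambda> (?N * g))"
      using sum.reindex_bij_betw[OF bij, of \<Lambda>] by simp
    also have "\<dots> = \<Lambda> ?N * (\<Sum>f\<in>monics (n - m). \<Lambda> f)"
      unfolding sum_distrib_left by (intro sum.cong refl mult N mb)
    finally show "(\<Sum>f\<in>monics n. if ?N dvd f then \<Lambda> f else 0) = \<Lambda> ?N * (\<Sum>f\<in>monics (n - m). \<Lambda> f)" .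
  qed
  finally show ?thesis by (simp only: sum_distrib_right)
qed

end

section \<open>Inverse roots and their power sums\<close>

text \<open>The logarithmic derivative of a product of factors \<open>1 - a T\<close>.\<close>

lemma fps_deriv_linear_factors:
  fixes as :: "complex list"
  shows "fps_deriv (\<Prod>a\<leftarrow>as. 1 - fps_const a * fps_X)
       = - Abs_fps (\<lambda>n. \<Sum>a\<leftarrow>as. a ^ Suc n) * (\<Prod>a\<leftarrow>as. 1 - fps_const a * fps_X)"
proof (induction as)
  case (Cons a as)
  define P where "P = (\<Prod>a\<leftarrow>as. 1 - fps_const a * fps_X)"
  define G where "G = Abs_fps (\<lambda>n. \<Sum>a\<leftarrow>as. a ^ Suc n)"
  define H where "H = Abs_fps (\<lambda>n. a ^ Suc n)"
  have H: "H * (1 - fps_const a * fps_X) = fps_const a"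
    by (rule fps_ext) (auto simp: H_def algebra_simps fps_X_mult_nth power_Suc[symmetric] simp del: power_Suc split: nat.splits)
  have G: "Abs_fps (\<lambda>n. \<Sum>a\<leftarrow>a # as. a ^ Suc n) = H + G"
    by (rule fps_ext) (simp add: H_def G_def)
  have IH: "fps_deriv P = - G * P" using Cons unfolding P_def G_def .
  have "fps_deriv (\<Prod>a\<leftarrow>a # as. 1 - fps_const a * fps_X) = fps_deriv ((1 - fps_const a * fps_X) * P)"
    by (simp add: P_def)
  also have "\<dots> = (1 - fps_const a * fps_X) * fps_deriv P - fps_const a * P"
    by (simp add: algebra_simps)
  also have "\<dots> = - (H + G) * ((1 - fps_const a * fps_X) * P)"
    unfolding IH by (subst H[symmetric]) (simp add: algebra_simps)
  finally show ?case unfolding G by (simp add: P_def)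
qed (simp add: fps_eq_iff)

text \<open>With \<open>L(T)\<close> the polynomial with coefficients \<open>A\<close>, the Newton relations say that the series of
\<open>S (n + 1)\<close> is the logarithmic derivative of \<open>L\<close>. Factoring \<open>L\<close> into linear factors \<open>1 - a T\<close>
computes that derivative a second time. A zero of \<open>L\<close> at 1 makes 1 an inverse root.\<close>

lemma newton_power_sums:
  fixes A S :: "nat \<Rightarrow> complex"
  assumes "A 0 = 1" and zero: "\<And>n. n \<ge> D \<Longrightarrow> A n = 0"
    and newton: "\<And>n. of_nat n * A n = (\<Sum>m=1..n. S m * A (n - m))"
  obtains as where "length as < D" "\<And>n. n \<ge> 1 \<Longrightarrow> S n = - (\<Sum>a\<leftarrow>as. a ^ n)"
    "(\<Sum>i<D. A i) = 0 \<Longrightarrow> 1 \<in> set as"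
proof -
  define p where "p = (\<Sum>i<D. monom (A i) i)"
  have co: "coeff p i = A i" for i
    using zero by (auto simp: p_def coeff_sum sum.delta')
  have D: "D > 0" using assms(1) zero[of 0] by (cases D) auto
  have p0: "p \<noteq> 0" using co[of 0] assms(1) by auto
  have deg: "degree p < D"
    using degree_le[of "D - 1" p] zero co D by (metis Suc_pred' le_imp_less_Suc Suc_leI)
  \<comment> \<open>The reciprocal polynomial is monic, and its roots are the inverse roots of \<open>p\<close>.\<close>
  define r where "r = reflect_poly p"
  have r: "degree r = degree p" "lead_coeff r = 1" "r \<noteq> 0"
    using co[of 0] assms(1) p0 by (auto simp: r_def coeff_reflect_poly)
  obtain M where M: "size M = degree r" "r = smult (lead_coeff r) (\<Prod>x\<in>#M. [:-x, 1:])"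
    using alg_closed_imp_factorization[OF r(3)] by blast
  obtain as where as: "mset as = M" using ex_mset by blast
  have "r = (\<Prod>x\<leftarrow>as. [:-x, 1:])" using M(2) r(2) unfolding as[symmetric]
    by (metis mset_map prod_mset_prod_list smult_1_left)
  moreover have "reflect_poly [:-x, 1:] = [:1, -x:]" for x :: complex
    by (rule poly_eqI) (auto simp: coeff_reflect_poly coeff_pCons split: nat.splits)
  moreover have "p = reflect_poly r" using co[of 0] assms(1) by (simp add: r_def)
  ultimately have p: "p = (\<Prod>x\<leftarrow>as. [:1, -x:])"
    by (simp add: reflect_poly_prod_list o_def)
  have len: "length as < D" using M(1) as r(1) deg by auto
  have "fps_of_poly (\<Prod>x\<leftarrow>as. [:1, -x:]) = (\<Prod>a\<leftarrow>as. 1 - fps_const a * fps_X)" for as :: "complex list"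
  proof (induction as)
    case (Cons a as)
    have "fps_of_poly [:1, -a:] = 1 - fps_const a * fps_X"
      by (rule fps_ext) (auto simp: fps_X_def coeff_pCons split: nat.splits)
    then show ?case using Cons by (simp add: fps_of_poly_mult del: mult_pCons_left)
  qed simp
  then have L: "Abs_fps A = (\<Prod>a\<leftarrow>as. 1 - fps_const a * fps_X)"
    using p co by (metis fps_ext fps_nth_Abs_fps fps_of_poly_nth)
  have "fps_deriv (Abs_fps A) = Abs_fps (\<lambda>n. S (Suc n)) * Abs_fps A"
  proof (rule fps_ext)
    fix n
    have "fps_deriv (Abs_fps A) $ n = (\<Sum>m=1..Suc n. S m * A (Suc n - m))"
      using newton[of "Suc n"] by simp
    also have "\<dots> = (\<Sum>i=0..n. S (Suc i) * A (n - i))"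
      using sum.shift_bounds_cl_Suc_ivl[of "\<lambda>m. S m * A (Suc n - m)" 0 n] by simp
    finally show "fps_deriv (Abs_fps A) $ n = (Abs_fps (\<lambda>n. S (Suc n)) * Abs_fps A) $ n"
      by (simp add: fps_mult_nth)
  qed
  then have "Abs_fps (\<lambda>n. S (Suc n)) * Abs_fps A = - Abs_fps (\<lambda>n. \<Sum>a\<leftarrow>as. a ^ Suc n) * Abs_fps A"
    using fps_deriv_linear_factors[of as] unfolding L by simp
  moreover have "Abs_fps A \<noteq> 0" using assms(1) by (metis fps_nth_Abs_fps fps_zero_nth zero_neq_one)
  ultimately have "Abs_fps (\<lambda>n. S (Suc n)) = - Abs_fps (\<lambda>n. \<Sum>a\<leftarrow>as. a ^ Suc n)"
    using mult_right_cancel by blast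
  then have S: "S (Suc n) = - (\<Sum>a\<leftarrow>as. a ^ Suc n)" for n
    by (metis fps_nth_Abs_fps fps_neg_nth)
  show ?thesis
  proof (rule that[OF len])
    show "S n = - (\<Sum>a\<leftarrow>as. a ^ n)" if "n \<ge> 1" for n using S[of "n - 1"] that by simp
    assume "(\<Sum>i<D. A i) = 0"
    then have "poly p 1 = 0" by (simp add: p_def poly_sum poly_monom)
    moreover have "poly (\<Prod>x\<leftarrow>bs. [:1, -x:]) 1 = (\<Prod>x\<leftarrow>bs. 1 - x)" for bs :: "complex list"
      by (induction bs) (simp_all del: mult_pCons_left)
    ultimately have "(\<Prod>x\<leftarrow>as. 1 - x) = 0" by (simp only: p)
    then show "1 \<in> set as" by (auto simp: prod_list_zero_iff)
  qed
qed

lemma sum_list_map_single: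
  fixes f :: "'a \<Rightarrow> 'b::semiring_1"
  assumes "\<And>x. x \<in> set xs \<Longrightarrow> x \<noteq> a \<Longrightarrow> f x = 0"
  shows "(\<Sum>x\<leftarrow>xs. f x) = of_nat (count_list xs a) * f a"
  using assms by (induction xs) (auto simp: algebra_simps)

text \<open>A linear combination of the power sums of orders \<open>k, k + 1, \<dots>\<close> isolates a single number: with the
coefficients of a polynomial vanishing at all others, it is a nonzero multiple of \<open>a ^ k\<close>. So
\<open>a ^ k\<close> obeys a bound of the same growth, which is impossible for all large \<open>k\<close> if \<open>a\<close> is too
large.\<close>

lemma power_sum_bound:
  fixes as :: "complex list"
  assumes bound: "\<And>k. k \<ge> k0 \<Longrightarrow> cmod (\<Sum>a\<leftarrow>as. a ^ k) \<le> C * R ^ k"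
    and R: "R > 0" and a: "a \<in> set as"
  shows "cmod a \<le> R"
proof (rule ccontr)
  assume "\<not> cmod a \<le> R"
  \<comment> \<open>The polynomial that vanishes at all the other numbers in the list.\<close>
  define c where "c = (\<Prod>b\<in>set as - {a}. [:-b, 1:])"
  define K where "K = of_nat (count_list as a) * poly c a"
  have "count_list as a \<noteq> 0" using a by (simp add: count_list_0_iff)
  moreover have "poly c a \<noteq> 0" by (auto simp: c_def poly_prod)
  ultimately have K: "cmod K > 0" by (simp add: K_def)
  define C' where "C' = (\<Sum>j\<le>degree c. cmod (coeff c j) * (C * R ^ j))"
  have main: "cmod K * cmod a ^ k \<le> C' * R ^ k" if k: "k \<ge> k0" for k
  proof -
    have "poly c x = 0" if "x \<in> set as" "x \<noteq> a" for x using that by (auto simp: c_def poly_prod)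
    then have "K * a ^ k = (\<Sum>x\<leftarrow>as. x ^ k * poly c x)"
      using sum_list_map_single[of as a "\<lambda>x. x ^ k * poly c x"] by (simp add: K_def)
    also have "\<dots> = (\<Sum>j\<le>degree c. coeff c j * (\<Sum>x\<leftarrow>as. x ^ (k + j)))"
    proof -
      have "(\<Sum>x\<leftarrow>bs. x ^ k * poly c x) = (\<Sum>j\<le>degree c. coeff c j * (\<Sum>x\<leftarrow>bs. x ^ (k + j)))" for bs
        by (induction bs) (auto simp: poly_altdef sum_distrib_left sum.distrib power_add algebra_simps)
      then show ?thesis .
    qed
    finally have "cmod (K * a ^ k) \<le> (\<Sum>j\<le>degree c. cmod (coeff c j) * cmod (\<Sum>x\<leftarrow>as. x ^ (k + j)))"
      by (metis (no_types, lifting) norm_mult norm_sum sum.cong)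
    also have "\<dots> \<le> (\<Sum>j\<le>degree c. cmod (coeff c j) * (C * R ^ (k + j)))"
      by (intro sum_mono mult_left_mono bound) (use k in auto)
    also have "\<dots> = C' * R ^ k" unfolding C'_def sum_distrib_right by (simp add: power_add mult_ac)
    finally show ?thesis by (simp add: norm_mult norm_power)
  qed
  define x where "x = cmod a / R"
  have x: "x > 1" using \<open>\<not> cmod a \<le> R\<close> R by (simp add: x_def)
  obtain n where n: "C' / cmod K < x ^ n" using real_arch_pow[OF x] by blast
  also have "\<dots> \<le> x ^ (n + k0)" using x by (intro power_increasing) auto
  also have "\<dots> \<le> C' / cmod K"
    using main[of "n + k0"] K R by (simp add: x_def power_divide field_simps)
  finally show False by simp
qed

section \<open>Few points on a level set of a norm\<close>

text \<open>The term of least order at \<open>x\<close> cannot be cancelled by the others.\<close>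

lemma sum_distinct_orders_nonzero:
  fixes h :: "'i \<Rightarrow> 'k::field poly"
  assumes fin: "finite I" and inj: "inj_on n I" and h: "\<And>t. t \<in> I \<Longrightarrow> poly (h t) x \<noteq> 0"
    and u: "u \<in> I" "\<kappa> u \<noteq> 0"
  shows "(\<Sum>t\<in>I. smult (\<kappa> t) ([:-x, 1:] ^ n t * h t)) \<noteq> 0"
proof -
  define J where "J = {t \<in> I. \<kappa> t \<noteq> 0}"
  have J: "finite J" "J \<noteq> {}" "J \<subseteq> I" using fin u by (auto simp: J_def)
  obtain v where v: "v \<in> J" "\<And>t. t \<in> J \<Longrightarrow> n v \<le> n t"
    using ex_min_if_finite[of "n ` J"] J by (auto simp: not_less)
  define G where "G = (\<Sum>t\<in>J. smult (\<kappa> t) ([:-x, 1:] ^ (n t - n v) * h t))"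
  have "(\<Sum>t\<in>I. smult (\<kappa> t) ([:-x, 1:] ^ n t * h t)) = (\<Sum>t\<in>J. smult (\<kappa> t) ([:-x, 1:] ^ n t * h t))"
    by (rule sum.mono_neutral_right) (use fin in \<open>auto simp: J_def\<close>)
  also have "\<dots> = [:-x, 1:] ^ n v * G"
    unfolding G_def sum_distrib_left
  proof (rule sum.cong)
    fix t assume "t \<in> J"
    then have "[:-x, 1:] ^ n t = [:-x, 1:] ^ n v * [:-x, 1:] ^ (n t - n v)"
      using v(2) by (simp flip: power_add)
    then show "smult (\<kappa> t) ([:-x, 1:] ^ n t * h t) = [:-x, 1:] ^ n v * smult (\<kappa> t) ([:-x, 1:] ^ (n t - n v) * h t)"
      by (simp only: mult_smult_right mult.assoc)
  qed simp
  finally have eq: "(\<Sum>t\<in>I. smult (\<kappa> t) ([:-x, 1:] ^ n t * h t)) = [:-x, 1:] ^ n v * G" .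
  have "poly G x = (\<Sum>t\<in>J. \<kappa> t * (0 ^ (n t - n v) * poly (h t) x))"
    by (simp add: G_def poly_sum)
  also have "\<dots> = (\<Sum>t\<in>{v}. \<kappa> t * (0 ^ (n t - n v) * poly (h t) x))"
  proof (rule sum.mono_neutral_right)
    show "\<forall>t\<in>J - {v}. \<kappa> t * (0 ^ (n t - n v) * poly (h t) x) = 0"
    proof
      fix t assume t: "t \<in> J - {v}"
      then have "n t \<noteq> n v" using inj_onD[OF inj, of t v] v(1) J(3) by auto
      then have "n t - n v > 0" using v(2)[of t] t by auto
      then show "\<kappa> t * (0 ^ (n t - n v) * poly (h t) x) = 0" by simp
    qed
  qed (use J v in auto)
  also have "\<dots> \<noteq> 0" using v(1) h by (auto simp: J_def)
  finally have "G \<noteq> 0" by auto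
  then show ?thesis unfolding eq by simp
qed

text \<open>Multiplied by \<open>d\<close>, the number \<open>b + P * j + s * i\<close> is \<open>P * (d * j + i)\<close> plus the small
error \<open>d * b - i\<close>, and two such errors differ by less than \<open>P\<close>. Hence \<open>d * j + i\<close> can be read off,
and with it \<open>i\<close>, \<open>j\<close> and \<open>b\<close>.\<close>

lemma mixed_radix_inj:
  fixes P d s :: nat
  assumes P: "P = d * s + 1"
  shows "inj_on (\<lambda>(i, j, b). b + P * j + s * i) ({..<d} \<times> {..<J} \<times> {..<s})"
proof (rule inj_onI, clarsimp)
  fix i j b i' j' b'
  assume lt: "i < d" "b < s" "i' < d" "b' < s" and eq: "b + P * j + s * i = b' + P * j' + s * i'"
  let ?x = "(int d * int j + int i) - (int d * int j' + int i')"
  have "int d * (int b + int P * int j + int s * int i) = int d * (int b' + int P * int j' + int s * int i')"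
    using arg_cong[OF eq, of int] by simp
  then have "int P * ?x = (int i - int i') + int d * (int b' - int b)"
    unfolding P by (simp add: algebra_simps)
  moreover have "\<bar>(int i - int i') + int d * (int b' - int b)\<bar> < int P"
  proof -
    have "\<bar>int d * (int b' - int b)\<bar> \<le> int d * (int s - 1)"
      unfolding abs_mult using lt by (intro mult_mono) auto
    moreover have "\<bar>int i - int i'\<bar> \<le> int d - 1" using lt by auto
    ultimately have "\<bar>(int i - int i') + int d * (int b' - int b)\<bar> \<le> int d - 1 + int d * (int s - 1)" by linarith
    then show ?thesis unfolding P by (simp add: algebra_simps)
  qed
  ultimately have "int P * \<bar>?x\<bar> < int P * 1" by (simp add: abs_mult)
  then have "?x = 0" using P by (simp only: mult_less_cancel_left) auto
  then have *: "d * j + i = d * j' + i'" by (metis (mono_tags, lifting) eq_iff_diff_eq_0 of_nat_add of_nat_eq_iff of_nat_mult)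
  have "(d * j + i) div d = j" "(d * j' + i') div d = j'" using lt by auto
  with * have "j = j'" by simp
  with * have "i = i'" by simp
  with eq \<open>j = j'\<close> show "i = i' \<and> j = j' \<and> b = b'" by simp
qed

context frobenius_closure
begin

definition poly_over :: "nat \<Rightarrow> 'k poly \<Rightarrow> bool" where
  "poly_over n f \<longleftrightarrow> (\<forall>i. coeff f i \<in> GF n)"

lemma poly_over_mult: "poly_over n f \<Longrightarrow> poly_over n g \<Longrightarrow> poly_over n (f * g)"
  by (simp add: poly_over_def coeff_mult GF_sum GF_mult)
lemma poly_over_smult: "c \<in> GF n \<Longrightarrow> poly_over n f \<Longrightarrow> poly_over n (smult c f)"
  by (simp add: poly_over_def GF_mult)
lemma poly_over_power: "poly_over n f \<Longrightarrow> poly_over n (f ^ k)"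
proof (induction k)
  case 0
  then show ?case by (simp add: poly_over_def coeff_1)
qed (simp add: poly_over_mult)
lemma poly_over_sum: "(\<And>i. i \<in> A \<Longrightarrow> poly_over n (f i)) \<Longrightarrow> poly_over n (\<Sum>i\<in>A. f i)"
  by (simp add: poly_over_def coeff_sum GF_sum)
lemma poly_over_linear: "a \<in> GF n \<Longrightarrow> b \<in> GF n \<Longrightarrow> poly_over n [:a, b:]"
  by (simp add: poly_over_def coeff_pCons split: nat.splits)
lemma poly_over_eval: "poly_over n f \<Longrightarrow> x \<in> GF n \<Longrightarrow> poly f x \<in> GF n"
  by (simp add: poly_over_def poly_altdef GF_sum GF_mult GF_power)

lemma card_bounded_degree:
  assumes n: "n > 0"
  shows "finite {f. poly_over n f \<and> (\<forall>i\<ge>E. coeff f i = 0)}" (is "finite ?S")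
    and "card {f. poly_over n f \<and> (\<forall>i\<ge>E. coeff f i = 0)} \<le> (q ^ n) ^ E"
proof -
  let ?r = "\<lambda>f. restrict (coeff f) {..<E}" and ?T = "{..<E} \<rightarrow>\<^sub>E GF n"
  have inj: "inj_on ?r ?S"
  proof (rule inj_onI)
    fix f g assume f: "f \<in> ?S" and g: "g \<in> ?S" and eq: "?r f = ?r g"
    show "f = g"
    proof (rule poly_eqI)
      fix i show "coeff f i = coeff g i"
        using f g fun_cong[OF eq, of i] by (cases "i < E") auto
    qed
  qed
  have img: "?r ` ?S \<subseteq> ?T" by (rule image_subsetI, unfold restrict_PiE_iff) (simp add: poly_over_def)
  have finT: "finite ?T" using finite_card_GF[OF n] by (intro finite_PiE) auto
  show "finite ?S" using inj_on_finite[OF inj img finT] .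
  show "card ?S \<le> (q ^ n) ^ E"
    using card_inj_on_le[OF inj img finT] finite_card_GF[OF n] by (simp add: card_PiE)
qed

text \<open>Bombieri's form of the method of Stepanov. Let \<open>P = q ^ a\<close> and \<open>\<gamma> = g ^ s\<close>, so that
\<open>\<gamma>(x) ^ P * \<gamma>(x) = z\<close> on the level set. Consider the polynomials

  \<open>F = \<Sum> \<kappa>(i, j, b) (X - x0) ^ (b + P * j) \<gamma> ^ i\<close>

with \<open>i < d\<close>, \<open>b < s\<close> and \<open>j < J\<close>. At a point \<open>x\<close> of the level set, \<open>(x - x0) ^ (P * P) = x - x0\<close>
and \<open>\<gamma>(x) ^ P = z / \<gamma>(x)\<close>, so \<open>F(x) ^ P * \<gamma>(x) ^ d\<close> is the value at \<open>x\<close> of another polynomial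
\<open>R\<close>, of much smaller degree than \<open>F ^ P\<close> and additive in \<open>\<kappa>\<close>. For \<open>J\<close> slightly larger than \<open>s\<close> there
are more coefficient families \<open>\<kappa>\<close> than polynomials of that degree, so \<open>R\<close> vanishes identically for some
nonzero \<open>\<kappa>\<close>, and then \<open>F\<close> vanishes on the level set. Here \<open>F\<close> itself is not zero: as \<open>g\<close> has a
simple zero at \<open>x0\<close>, the terms of \<open>F\<close> vanish there to pairwise distinct orders. So the level set has
at most as many points as the degree of \<open>F\<close>.\<close>

lemma level_set_bound:
  fixes g g0 :: "'k poly" and a d s m :: nat and x0 z :: 'k
  defines "P \<equiv> q ^ a" and "m \<equiv> degree g"
  assumes P: "q ^ a = d * s + 1"
    and x0: "x0 \<in> GF (2 * a)" and g0: "poly_over (2 * a) g0" "poly g0 x0 \<noteq> 0"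
    and g: "g = [:-x0, 1:] * g0" and z: "z \<in> GF (2 * a)" "z \<noteq> 0" and big: "s + m + 2 < P"
  shows "card {x \<in> GF (2 * a). poly g x ^ (s * (P + 1)) = z} \<le> (s + 2 * m + 2) * P"
proof -
  \<comment> \<open>Just large enough for the counting argument below; the degree of \<open>F\<close> is about \<open>P * J\<close>.\<close>
  define J where "J = s + m + 2"
  define I where "I = {..<d} \<times> {..<J} \<times> {..<s}"
  define L where "L = [:-x0, 1:]"
  have P1: "P = d * s + 1" using P by (simp add: P_def)
  have a0: "a > 0" using big by (cases a) (auto simp: P_def)
  have fin: "finite (GF (2 * a))" "card (GF (2 * a)) = P * P"
    using finite_card_GF[of "2 * a"] a0 by (auto simp: P_def power_add mult_2)
  have Xo: "poly_over (2 * a) L" unfolding L_def using x0 by (intro poly_over_linear GF_minus) auto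
  have go: "poly_over (2 * a) g" unfolding g using Xo g0 by (simp only: L_def poly_over_mult)
  define \<gamma> where "\<gamma> = g ^ s"
  have \<gamma>o: "poly_over (2 * a) \<gamma>" unfolding \<gamma>_def by (rule poly_over_power[OF go])
  have deg\<gamma>: "degree (\<gamma> ^ i) \<le> m * (s * i)" for i
    using degree_power_le[of g "s * i"] by (simp add: \<gamma>_def m_def power_mult)
  have degX: "degree (L ^ n) = n" for n by (simp add: L_def degree_power_eq)
  define tF where "tF = (\<lambda>(i, j, b). L ^ (b + P * j) * \<gamma> ^ i)"
  define tR where "tR = (\<lambda>(i, j, b). smult (z ^ i) (L ^ (P * b + j) * \<gamma> ^ (d - i)))"
  define F where "F = (\<lambda>\<kappa>. \<Sum>t\<in>I. smult (\<kappa> t) (tF t))"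
  define R where "R = (\<lambda>\<kappa>. \<Sum>t\<in>I. smult (\<kappa> t ^ P) (tR t))"
  define E where "E = P * s + J + m * P"
  define Dom where "Dom = I \<rightarrow>\<^sub>E GF (2 * a)"
  let ?Cod = "{f. poly_over (2 * a) f \<and> (\<forall>i\<ge>E. coeff f i = 0)}"
  have finI: "finite I" and cardI: "card I = d * (J * s)" by (simp_all add: I_def)
  have "R ` Dom \<subseteq> ?Cod"
  proof safe
    fix \<kappa> assume \<kappa>: "\<kappa> \<in> Dom"
    show "poly_over (2 * a) (R \<kappa>)"
      unfolding R_def tR_def
      by (rule poly_over_sum)
         (use \<kappa> z Xo \<gamma>o in \<open>auto simp: Dom_def intro!: poly_over_smult poly_over_mult poly_over_power GF_power\<close>)
    fix n assume n: "n \<ge> E"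
    have "degree (tR t) < E" if "t \<in> I" for t
    proof -
      obtain i j b where t: "t = (i, j, b)" by (cases t)
      have lt: "i < d" "j < J" "b < s" using that by (auto simp: t I_def)
      have "degree (tR t) \<le> degree (L ^ (P * b + j) * \<gamma> ^ (d - i))" by (simp add: tR_def t degree_smult_le)
      also have "\<dots> \<le> (P * b + j) + m * (s * (d - i))"
        using degree_mult_le[of "L ^ (P * b + j)" "\<gamma> ^ (d - i)"] degX[of "P * b + j"] deg\<gamma>[of "d - i"] by linarith
      also have "\<dots> \<le> P * s + j + m * P"
      proof -
        have "P * b \<le> P * s" using lt by simp
        moreover have "s * (d - i) \<le> P" using le_trans[of "s * (d - i)" "s * d" P] P1 by (simp add: mult.commute)
        then have "m * (s * (d - i)) \<le> m * P" by simp
        ultimately show ?thesis by linarith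
      qed
      also have "\<dots> < E" using lt by (simp add: E_def)
      finally show ?thesis .
    qed
    then have "coeff (tR t) n = 0" if "t \<in> I" for t using that n by (meson coeff_eq_0 less_le_trans)
    then show "coeff (R \<kappa>) n = 0" by (simp add: R_def coeff_sum)
  qed
  then have "card (R ` Dom) \<le> card ?Cod"
    by (rule card_mono[rotated]) (rule card_bounded_degree(1), use a0 in simp)
  also have "\<dots> \<le> (P * P) ^ E"
    using card_bounded_degree(2)[of "2 * a" E] a0 by (simp add: P_def mult_2 power_add)
  \<comment> \<open>The pigeonhole: there are more coefficient families than possible values of \<open>R\<close>.\<close>
  also have "\<dots> < (P * P) ^ card I"
  proof (rule power_strict_increasing)
    have "P > 1" using big by simp
    then show "1 < P * P" using less_1_mult by blast
    have "(d * s) * J + J = P * J" by (simp add: P1)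
    moreover have "P * J = P * s + m * P + 2 * P" by (simp add: J_def algebra_simps)
    moreover have "2 * P > 2 * J" using big by (simp add: J_def)
    ultimately show "E < card I" unfolding E_def cardI by (simp add: mult_ac)
  qed
  also have "\<dots> = card Dom" using fin finI by (simp add: Dom_def card_PiE)
  finally have "\<not> inj_on R Dom" by (metis card_image less_irrefl)
  then obtain \<kappa>1 \<kappa>2 where \<kappa>: "\<kappa>1 \<in> Dom" "\<kappa>2 \<in> Dom" "\<kappa>1 \<noteq> \<kappa>2" "R \<kappa>1 = R \<kappa>2"
    by (auto simp: inj_on_def)
  \<comment> \<open>\<open>R\<close> is additive, although not linear, since \<open>P\<close> is a power of the characteristic.\<close>
  define \<kappa> where "\<kappa> = (\<lambda>t. \<kappa>1 t - \<kappa>2 t)"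
  have "R \<kappa> = R \<kappa>1 - R \<kappa>2"
    by (simp add: R_def \<kappa>_def P_def frob_diff smult_diff_left sum_subtractf)
  then have R0: "R \<kappa> = 0" using \<kappa> by simp
  obtain u where u: "u \<in> I" "\<kappa> u \<noteq> 0"
    using \<kappa>(1-3) unfolding Dom_def \<kappa>_def by (metis PiE_ext eq_iff_diff_eq_0)
  define n where "n = (\<lambda>(i, j, b). b + P * j + s * i)"
  define h where "h = (\<lambda>(i, j :: nat, b :: nat). g0 ^ (s * i))"
  have "F \<kappa> = (\<Sum>t\<in>I. smult (\<kappa> t) ([:-x0, 1:] ^ n t * h t))"
    unfolding F_def
  proof (rule sum.cong)
    fix t :: "nat \<times> nat \<times> nat"
    obtain i j b where t: "t = (i, j, b)" by (cases t)
    have "tF t = [:-x0, 1:] ^ (b + P * j + s * i) * g0 ^ (s * i)"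
      unfolding tF_def t \<gamma>_def g L_def prod.case
      by (simp only: power_mult_distrib power_mult[symmetric] power_add mult.assoc)
    then show "smult (\<kappa> t) (tF t) = smult (\<kappa> t) ([:-x0, 1:] ^ n t * h t)"
      by (simp only: t prod.case n_def h_def)
  qed simp
  also have "\<dots> \<noteq> 0"
  proof (rule sum_distinct_orders_nonzero[where u = u and n = n and h = h])
    show "inj_on n I" unfolding n_def I_def by (rule mixed_radix_inj[OF P1])
    show "poly (h t) x0 \<noteq> 0" for t using g0 by (cases t) (simp add: h_def)
  qed (use finI u in auto)
  finally have F0: "F \<kappa> \<noteq> 0" .
  have degF: "degree (F \<kappa>) \<le> P * J + m * P"
    unfolding F_def
  proof (rule degree_sum_le[OF finI])
    fix t assume tI: "t \<in> I"
    obtain i j b where t: "t = (i, j, b)" by (cases t)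
    have lt: "i < d" "j < J" "b < s" using tI by (auto simp: t I_def)
    have "degree (smult (\<kappa> t) (tF t)) \<le> degree (L ^ (b + P * j) * \<gamma> ^ i)"
      by (simp add: tF_def t degree_smult_le)
    also have "\<dots> \<le> (b + P * j) + m * (s * i)"
      using degree_mult_le[of "L ^ (b + P * j)" "\<gamma> ^ i"] degX[of "b + P * j"] deg\<gamma>[of i] by linarith
    also have "\<dots> \<le> P * J + m * P"
    proof -
      have "b \<le> P" using lt big by simp
      moreover have "P * j + P \<le> P * J" using lt by (metis Suc_leI mult_Suc_right mult_le_mono2 add.commute)
      moreover have "s * i \<le> P" using le_trans[of "s * i" "s * d" P] P1 lt by (simp add: mult.commute)
      then have "m * (s * i) \<le> m * P" by simp
      ultimately show ?thesis by linarith
    qed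
    finally show "degree (smult (\<kappa> t) (tF t)) \<le> P * J + m * P" .
  qed
  have "poly (F \<kappa>) x = 0" if x: "x \<in> GF (2 * a)" and gx: "poly g x ^ (s * (P + 1)) = z" for x
  proof -
    define y where "y = poly \<gamma> x"
    define w where "w = poly L x"
    have "poly g x ^ (s * (P + 1)) = (poly g x ^ s) ^ P * poly g x ^ s"
      by (simp only: power_mult power_add power_one_right)
    then have yP: "y ^ P * y = z" using gx by (simp add: y_def \<gamma>_def)
    then have y0: "y \<noteq> 0" using z by auto
    have "w \<in> GF (2 * a)" unfolding w_def using poly_over_eval[OF Xo x] .
    then have wP: "w ^ (P * P) = w" by (simp add: GF_iff P_def power_add mult_2)
    have "poly (F \<kappa>) x ^ P * y ^ d = (\<Sum>t\<in>I. (\<kappa> t * poly (tF t) x) ^ P) * y ^ d"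
      by (simp add: F_def poly_sum P_def frob_sum)
    also have "\<dots> = (\<Sum>t\<in>I. \<kappa> t ^ P * poly (tR t) x)"
      unfolding sum_distrib_right
    proof (rule sum.cong)
      fix t assume tI: "t \<in> I"
      obtain i j b where t: "t = (i, j, b)" by (cases t)
      have lt: "i < d" using tI by (auto simp: t I_def)
      have "y ^ d = y ^ i * y ^ (d - i)" using lt by (simp flip: power_add)
      moreover have "(y ^ i) ^ P = (y ^ P) ^ i" by (metis power_mult mult.commute)
      ultimately have 1: "(y ^ i) ^ P * y ^ d = z ^ i * y ^ (d - i)"
        by (simp only: yP[symmetric] power_mult_distrib mult.assoc)
      have "(b + P * j) * P = P * b + (P * P) * j" by (simp add: algebra_simps)
      then have "(w ^ (b + P * j)) ^ P = w ^ (P * b) * (w ^ (P * P)) ^ j"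
        by (metis power_mult power_add)
      then have 2: "(w ^ (b + P * j)) ^ P = w ^ (P * b + j)" by (simp only: wP power_add)
      have "(\<kappa> t * (w ^ (b + P * j) * y ^ i)) ^ P * y ^ d
          = \<kappa> t ^ P * ((w ^ (b + P * j)) ^ P * ((y ^ i) ^ P * y ^ d))"
        by (simp only: power_mult_distrib mult.assoc)
      also have "\<dots> = \<kappa> t ^ P * (z ^ i * (w ^ (P * b + j) * y ^ (d - i)))"
        unfolding 1 2 by (simp only: mult.left_commute)
      finally have "(\<kappa> t * (w ^ (b + P * j) * y ^ i)) ^ P * y ^ d
          = \<kappa> t ^ P * (z ^ i * (w ^ (P * b + j) * y ^ (d - i)))" .
      then show "(\<kappa> t * poly (tF t) x) ^ P * y ^ d = \<kappa> t ^ P * poly (tR t) x"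
        by (simp only: tF_def tR_def t w_def y_def prod.case poly_mult poly_power poly_smult)
    qed simp
    also have "\<dots> = poly (R \<kappa>) x" by (simp add: R_def poly_sum)
    finally show ?thesis using R0 y0 by simp
  qed
  then have "card {x \<in> GF (2 * a). poly g x ^ (s * (P + 1)) = z} \<le> card {x. poly (F \<kappa>) x = 0}"
    by (intro card_mono poly_roots_finite[OF F0]) auto
  also have "\<dots> \<le> P * J + m * P" using card_poly_roots_bound[OF F0] degF by linarith
  also have "\<dots> = (s + 2 * m + 2) * P" by (simp add: J_def algebra_simps)
  finally show ?thesis .
qed

end

section \<open>Character sums over large extensions\<close>

context frobenius_closure
begin

text \<open>For \<open>k > 0\<close>, raising to this power is the norm from \<open>GF (4 * k)\<close> to \<open>GF 2\<close>.\<close>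

definition norm_exponent :: "nat \<Rightarrow> nat" where
  "norm_exponent k = (q ^ (4 * k) - 1) div (q\<^sup>2 - 1)"

lemma q2_gt: "q\<^sup>2 - 1 \<ge> 3"
proof -
  have "2 ^ 2 \<le> q ^ 2" using q_gt_1 by (intro power_mono) auto
  then show ?thesis by simp
qed

lemma ex_cofactor: "\<exists>s. q ^ (2 * k) = (q\<^sup>2 - 1) * s + 1"
proof (induction k)
  case (Suc k)
  then obtain s where "q ^ (2 * k) = (q\<^sup>2 - 1) * s + 1" by blast
  moreover have "q\<^sup>2 = (q\<^sup>2 - 1) + 1" using q2_gt by linarith
  ultimately have "q ^ (2 * Suc k) = ((q\<^sup>2 - 1) * s + 1) * ((q\<^sup>2 - 1) + 1)"
    by (metis mult_Suc_right power_add mult.commute)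
  then have "q ^ (2 * Suc k) = (q\<^sup>2 - 1) * (s * (q\<^sup>2 - 1) + s + 1) + 1" by (simp add: algebra_simps)
  then show ?case by blast
qed simp

lemma norm_exponent_eq:
  assumes "q ^ (2 * k) = (q\<^sup>2 - 1) * s + 1"
  shows "norm_exponent k = s * (q ^ (2 * k) + 1)"
proof -
  have "q ^ (4 * k) = q ^ (2 * k) * q ^ (2 * k)" by (simp flip: power_add)
  also have "\<dots> = (q\<^sup>2 - 1) * (s * (q ^ (2 * k) + 1)) + 1" unfolding assms by (simp add: algebra_simps)
  finally show ?thesis using q2_gt by (simp add: norm_exponent_def)
qed

lemma norm_exponent_mult: "norm_exponent k * (q\<^sup>2 - 1) = q ^ (4 * k) - 1"
proof -
  obtain s where s: "q ^ (2 * k) = (q\<^sup>2 - 1) * s + 1" using ex_cofactor by blast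
  have "q ^ (4 * k) = q ^ (2 * k) * q ^ (2 * k)" by (simp flip: power_add)
  also have "\<dots> = (q\<^sup>2 - 1) * (s * (q ^ (2 * k) + 1)) + 1" unfolding s by (simp add: algebra_simps)
  finally show ?thesis unfolding norm_exponent_eq[OF s] by simp
qed

lemma norm_exponent_pos: "k > 0 \<Longrightarrow> norm_exponent k > 0"
proof -
  assume "k > 0"
  then have "q ^ (4 * k) > 1" using q_gt_1 by (intro one_less_power) auto
  then show ?thesis using norm_exponent_mult[of k] by (cases "norm_exponent k") auto
qed

lemma norm_exponent_in_GF2: 
  assumes "y \<in> GF (4 * k)" shows "y ^ norm_exponent k \<in> GF 2"
proof (cases "y = 0 \<or> k = 0")
  case True
  then show ?thesis using assms by (cases "k = 0") (auto simp: GF_iff norm_exponent_def power_0_left frob_0)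
next
  case False
  have "q ^ (4 * k) = Suc (norm_exponent k * (q\<^sup>2 - 1))" using norm_exponent_mult[of k] q_gt_1 by simp
  then have "y * y ^ (norm_exponent k * (q\<^sup>2 - 1)) = y * 1" using assms unfolding GF_iff by (simp del: power_Suc add: power_Suc[symmetric])
  then have 1: "y ^ (norm_exponent k * (q\<^sup>2 - 1)) = 1" using False by simp
  have "q\<^sup>2 = Suc (q\<^sup>2 - 1)" using q2_gt by linarith
  then have "(y ^ norm_exponent k) ^ q\<^sup>2 = y ^ norm_exponent k * y ^ (norm_exponent k * (q\<^sup>2 - 1))"
    by (metis power_Suc power_mult)
  then show ?thesis using 1 by (simp add: GF_iff)
qed

text \<open>Every nonzero value in \<open>GF 2\<close> is the norm of \<open>g(x)\<close> for at most \<open>U\<close> points \<open>x\<close>, and these upper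
bounds together exceed the number of points only by \<open>O(q ^ (2 * k))\<close>. Since the values of \<open>\<psi>\<close> sum to zero,
subtracting \<open>U\<close> from all the fibre sizes does not change the sum.\<close>

lemma nontrivial_character_sum_bound:
  fixes \<psi> :: "'k \<Rightarrow> complex" and g g0 :: "'k poly"
  assumes psi0: "\<psi> 0 = 0" and sum0: "(\<Sum>z\<in>GF 2. \<psi> z) = 0" and le1: "\<And>z. cmod (\<psi> z) \<le> 1"
    and x0: "x0 \<in> GF 4" and g0: "poly_over 4 g0" "poly g0 x0 \<noteq> 0" and g: "g = [:-x0, 1:] * g0"
  shows "\<exists>C k0. \<forall>k\<ge>k0. cmod (\<Sum>x\<in>GF (4 * k). \<psi> (poly g x ^ norm_exponent k)) \<le> C * real q ^ (2 * k)"
proof -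
  define m where "m = degree g"
  define D where "D = q\<^sup>2 - 1"
  define C where "C = real (D * (2 * m + 2) + m)"
  have "g0 \<noteq> 0" using g0 by auto
  then have gnz: "g \<noteq> 0" unfolding g by (simp del: mult_pCons_left)
  have finZ: "finite (GF 2)" and cardZ: "card (GF 2) = q\<^sup>2" using finite_card_GF[of 2] by auto
  define Z where "Z = GF 2 - {0}"
  have Z: "finite Z" "card Z = D" using finZ cardZ by (auto simp: Z_def D_def)
  have "cmod (\<Sum>x\<in>GF (4 * k). \<psi> (poly g x ^ norm_exponent k)) \<le> C * real q ^ (2 * k)"
    if k: "k \<ge> 2 * m + 6" for k
  proof -
    define P where "P = q ^ (2 * k)"
    obtain s where s: "P = D * s + 1" using ex_cofactor[of k] by (auto simp: P_def D_def)
    have nx: "norm_exponent k = s * (P + 1)" using norm_exponent_eq[of k s] s by (simp add: P_def D_def)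
    have "k < q ^ k" using q_gt_1 by (simp add: power_gt_expt)
    also have "\<dots> \<le> P" unfolding P_def using q_gt_1 by (intro power_increasing) auto
    finally have kP: "k < P" .
    have "D * s \<ge> 3 * s" using q2_gt by (simp add: D_def)
    then have big: "s + m + 2 < P" using s k kP by linarith
    have sub: "GF 4 \<subseteq> GF (4 * k)" by (rule GF_mono) simp
    have sub2: "GF 2 \<subseteq> GF (4 * k)" by (rule GF_mono) simp
    have finK: "finite (GF (4 * k))" and cardK: "card (GF (4 * k)) = P * P"
      using finite_card_GF[of "4 * k"] k by (auto simp: P_def simp flip: power_add)
    define N where "N = (\<lambda>z. card {x \<in> GF (4 * k). poly g x ^ norm_exponent k = z})"
    \<comment> \<open>The bound of \<open>level_set_bound\<close> for one value; \<open>D * U\<close> exceeds the number \<open>P * P\<close> of points by \<open>O(P)\<close> only.\<close>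
    define U where "U = (s + 2 * m + 2) * P"
    have N: "N z \<le> U" if "z \<in> Z" for z
    proof -
      have "card {x \<in> GF (2 * (2 * k)). poly g x ^ (s * (q ^ (2 * k) + 1)) = z} \<le> (s + 2 * degree g + 2) * q ^ (2 * k)"
      proof (rule level_set_bound)
        show "q ^ (2 * k) = D * s + 1" using s by (simp add: P_def)
        show "x0 \<in> GF (2 * (2 * k))" using x0 sub by auto
        show "poly_over (2 * (2 * k)) g0" using g0(1) sub by (auto simp: poly_over_def)
        show "poly g0 x0 \<noteq> 0" by (rule g0(2))
        show "g = [:- x0, 1:] * g0" by (rule g)
        show "z \<in> GF (2 * (2 * k))" "z \<noteq> 0" using that sub2 by (auto simp: Z_def)
        show "s + degree g + 2 < q ^ (2 * k)" using big by (simp add: P_def m_def)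
      qed
      then show ?thesis by (simp add: N_def U_def nx P_def m_def)
    qed
    have go: "poly_over (4 * k) g"
      unfolding g using x0 g0 sub by (intro poly_over_mult poly_over_linear GF_minus) (auto simp: poly_over_def)
    have nxpos: "norm_exponent k > 0" using norm_exponent_pos k by simp
    have mem: "poly g x ^ norm_exponent k \<in> GF 2" if "x \<in> GF (4 * k)" for x
      using norm_exponent_in_GF2 poly_over_eval[OF go that] by blast
    have "N 0 \<le> card {x. poly g x = 0}" unfolding N_def
      by (intro card_mono poly_roots_finite[OF gnz]) auto
    then have N0: "N 0 \<le> m" using card_poly_roots_bound[OF gnz] by (simp add: m_def)
    have "(\<Sum>z\<in>GF 2. N z) = P * P"
      using sum.group[OF finK finZ, of "\<lambda>x. poly g x ^ norm_exponent k" "\<lambda>_. 1::nat"] mem cardK by (auto simp: N_def)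
    then have sumN: "(\<Sum>z\<in>Z. N z) + N 0 = P * P"
      unfolding Z_def using sum.remove[OF finZ, of 0 N] by simp
    have "(\<Sum>x\<in>GF (4 * k). \<psi> (poly g x ^ norm_exponent k)) = (\<Sum>z\<in>GF 2. \<psi> z * of_nat (N z))"
    proof -
      have "(\<Sum>z\<in>GF 2. \<Sum>x | x \<in> GF (4 * k) \<and> poly g x ^ norm_exponent k = z. \<psi> (poly g x ^ norm_exponent k))
          = (\<Sum>x\<in>GF (4 * k). \<psi> (poly g x ^ norm_exponent k))"
        by (rule sum.group[OF finK finZ]) (use mem in auto)
      moreover have "(\<Sum>x | x \<in> GF (4 * k) \<and> poly g x ^ norm_exponent k = z. \<psi> (poly g x ^ norm_exponent k)) = \<psi> z * of_nat (N z)" for z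
        by (simp add: N_def mult.commute)
      ultimately show ?thesis by (simp only:)
    qed
    also have "\<dots> = (\<Sum>z\<in>Z. \<psi> z * of_nat (N z))"
      unfolding Z_def using sum.remove[OF finZ, of 0 "\<lambda>z. \<psi> z * of_nat (N z)"] psi0 by simp
    also have "\<dots> = - (\<Sum>z\<in>Z. \<psi> z * (of_nat U - of_nat (N z)))"
    proof -
      have "(\<Sum>z\<in>Z. \<psi> z) = 0" unfolding Z_def using sum.remove[OF finZ, of 0 \<psi>] psi0 sum0 by simp
      then have "(\<Sum>z\<in>Z. \<psi> z * of_nat U) = 0" by (simp flip: sum_distrib_right)
      then show ?thesis by (simp add: right_diff_distrib sum_subtractf)
    qed
    finally have "cmod (\<Sum>x\<in>GF (4 * k). \<psi> (poly g x ^ norm_exponent k)) \<le> (\<Sum>z\<in>Z. cmod (\<psi> z * (of_nat U - of_nat (N z))))"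
      by (simp add: norm_sum)
    also have "\<dots> \<le> (\<Sum>z\<in>Z. real (U - N z))"
    proof (rule sum_mono)
      fix z assume "z \<in> Z"
      then have "of_nat U - of_nat (N z) = (of_nat (U - N z) :: complex)" using N by (simp add: of_nat_diff)
      then have "cmod (\<psi> z * (of_nat U - of_nat (N z))) = cmod (\<psi> z) * real (U - N z)"
        by (simp only: norm_mult norm_of_nat)
      also have "\<dots> \<le> 1 * real (U - N z)" using le1 by (intro mult_right_mono) auto
      finally show "cmod (\<psi> z * (of_nat U - of_nat (N z))) \<le> real (U - N z)" by simp
    qed
    also have "\<dots> = real (\<Sum>z\<in>Z. U - N z)" by simp
    also have "\<dots> \<le> real ((D * (2 * m + 2) + m) * P)"
    proof -
      have "(\<Sum>z\<in>Z. U - N z) + (\<Sum>z\<in>Z. N z) = D * U"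
        using N Z by (simp flip: sum.distrib)
      moreover have "D * U = (D * s) * P + D * (2 * m + 2) * P" by (simp add: U_def algebra_simps)
      moreover have "(D * s) * P \<le> P * P" using s by simp
      moreover have "m \<le> m * P" using kP by simp
      ultimately have "(\<Sum>z\<in>Z. U - N z) \<le> D * (2 * m + 2) * P + m * P" using sumN N0 by linarith
      then show ?thesis by (simp only: add_mult_distrib of_nat_le_iff)
    qed
    finally show ?thesis by (simp add: C_def P_def)
  qed
  then show ?thesis by blast
qed

end

section \<open>L-functions with finitely many coefficients\<close>

context frobenius_closure
begin

text \<open>The L-function of \<open>\<Lambda>\<close> is a polynomial, and its inverse roots compute the character sums over all
extensions at once.\<close>

lemma L_function_roots:
  fixes \<Lambda> :: "'k poly \<Rightarrow> complex"
  assumes mult: "\<And>f g. base_poly f \<Longrightarrow> base_poly g \<Longrightarrow> \<Lambda> (f * g) = \<Lambda> f * \<Lambda> g"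
    and one: "\<Lambda> 1 = 1" and zero: "\<And>n. n \<ge> D \<Longrightarrow> (\<Sum>f\<in>monics n. \<Lambda> f) = 0"
  obtains as where "length as < D"
    "\<And>n. n \<ge> 1 \<Longrightarrow> (\<Sum>t\<in>GF n. \<Lambda> (orbit_poly n t)) = - (\<Sum>a\<leftarrow>as. a ^ n)"
    "(\<Sum>i<D. \<Sum>f\<in>monics i. \<Lambda> f) = 0 \<Longrightarrow> 1 \<in> set as"
proof -
  have "(\<Sum>f\<in>monics 0. \<Lambda> f) = 1" by (simp add: monics_0 one)
  from newton_power_sums[where A = "\<lambda>n. \<Sum>f\<in>monics n. \<Lambda> f" and S = "\<lambda>n. \<Sum>t\<in>GF n. \<Lambda> (orbit_poly n t)" and D = D,
      OF this zero newton_identity[OF mult]] that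
  show ?thesis by blast
qed

lemma orbit_poly_1: "orbit_poly 1 t = [:-t, 1:]"
  by (simp add: orbit_poly_def)

lemma sum_monics_split:
  fixes \<Lambda> :: "'k poly \<Rightarrow> complex"
  assumes "\<And>h. h \<in> monics (n - M) \<Longrightarrow> (\<Sum>r\<in>polys_below M. \<Lambda> (monom 1 M * h + r)) = 0" and "n \<ge> M"
  shows "(\<Sum>f\<in>monics n. \<Lambda> f) = 0"
proof -
  have "(\<Sum>f\<in>monics (M + (n - M)). \<Lambda> f)
      = (\<Sum>p\<in>monics (n - M) \<times> polys_below M. \<Lambda> (case p of (h, r) \<Rightarrow> monom 1 M * h + r))"
    by (rule sum.reindex_bij_betw[OF bij_monics_split, symmetric])
  also have "\<dots> = (\<Sum>h\<in>monics (n - M). \<Sum>r\<in>polys_below M. \<Lambda> (monom 1 M * h + r))"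
    unfolding sum.cartesian_product by (rule sum.cong) auto
  finally show ?thesis using assms by simp
qed

text \<open>A nonzero polynomial is a nonzero constant times a monic one. If \<open>\<Lambda>\<close> ignores the constant, this relates the
value of its L-function at 1 to a sum over a full residue system.\<close>

lemma sum_polys_below_scaling:
  fixes \<Lambda> :: "'k poly \<Rightarrow> complex"
  assumes "\<Lambda> 0 = 0" and scale: "\<And>a f. a \<in> GF 1 \<Longrightarrow> a \<noteq> 0 \<Longrightarrow> base_poly f \<Longrightarrow> \<Lambda> (smult a f) = \<Lambda> f"
  shows "(\<Sum>r\<in>polys_below M. \<Lambda> r) = of_nat (q - 1) * (\<Sum>n<M. \<Sum>f\<in>monics n. \<Lambda> f)"
proof (induction M)
  case 0
  have "polys_below 0 = {0}" by (auto simp: polys_below_def base_poly_def poly_eq_iff)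
  then show ?case using assms by simp
next
  case (Suc M)
  have sub: "polys_below M \<subseteq> polys_below (Suc M)" by (auto simp: polys_below_def)
  have bij: "bij_betw (\<lambda>(a, f). smult a f) ((GF 1 - {0}) \<times> monics M) (polys_below (Suc M) - polys_below M)"
  proof (rule bij_betwI[where g = "\<lambda>r. (coeff r M, smult (inverse (coeff r M)) r)"])
    show "(\<lambda>(a, f). smult a f) \<in> (GF 1 - {0}) \<times> monics M \<rightarrow> polys_below (Suc M) - polys_below M"
      by (auto simp: polys_below_def monics_def base_poly_def coeff_eq_0 intro!: GF_mult exI[of _ M])
    show "(\<lambda>r. (coeff r M, smult (inverse (coeff r M)) r)) \<in> polys_below (Suc M) - polys_below M \<rightarrow> (GF 1 - {0}) \<times> monics M"
    proof
      fix r assume r: "r \<in> polys_below (Suc M) - polys_below M"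
      have nz: "coeff r M \<noteq> 0"
      proof
        assume "coeff r M = 0"
        then have "\<forall>i\<ge>M. coeff r i = 0" using r by (auto simp: polys_below_def) (metis le_neq_implies_less Suc_leI)
        then show False using r by (auto simp: polys_below_def)
      qed
      have "degree r = M"
        by (rule antisym) (use r nz in \<open>auto simp: polys_below_def intro!: degree_le le_degree\<close>)
      then show "(coeff r M, smult (inverse (coeff r M)) r) \<in> (GF 1 - {0}) \<times> monics M"
        using r nz GF_divide[of _ 1 "coeff r M"]
        by (auto simp: polys_below_def monics_def base_poly_def divide_inverse mult.commute)
    qed
    show "(coeff ((\<lambda>(a, f). smult a f) p) M, smult (inverse (coeff ((\<lambda>(a, f). smult a f) p) M)) ((\<lambda>(a, f). smult a f) p)) = p"
      if "p \<in> (GF 1 - {0}) \<times> monics M" for p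
      using that by (auto simp: monics_def)
    show "(\<lambda>(a, f). smult a f) (coeff r M, smult (inverse (coeff r M)) r) = r" if "r \<in> polys_below (Suc M) - polys_below M" for r
    proof -
      have "coeff r M \<noteq> 0"
      proof
        assume "coeff r M = 0"
        then have "\<forall>i\<ge>M. coeff r i = 0" using that by (auto simp: polys_below_def) (metis le_neq_implies_less Suc_leI)
        then show False using that by (auto simp: polys_below_def)
      qed
      then show ?thesis by simp
    qed
  qed
  have "(\<Sum>r\<in>polys_below (Suc M). \<Lambda> r) = (\<Sum>r\<in>polys_below (Suc M) - polys_below M. \<Lambda> r) + (\<Sum>r\<in>polys_below M. \<Lambda> r)"
    by (rule sum.subset_diff[OF sub finite_polys_below])
  also have "(\<Sum>r\<in>polys_below (Suc M) - polys_below M. \<Lambda> r) = (\<Sum>p\<in>(GF 1 - {0}) \<times> monics M. \<Lambda> (case p of (a, f) \<Rightarrow> smult a f))"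
    by (rule sum.reindex_bij_betw[OF bij, symmetric])
  also have "\<dots> = (\<Sum>p\<in>(GF 1 - {0}) \<times> monics M. case p of (a, f) \<Rightarrow> \<Lambda> f)"
    by (rule sum.cong) (auto intro!: scale simp: monics_def)
  also have "\<dots> = (\<Sum>a\<in>GF 1 - {0}. \<Sum>f\<in>monics M. \<Lambda> f)"
    by (rule sum.cartesian_product[symmetric])
  also have "\<dots> = of_nat (q - 1) * (\<Sum>f\<in>monics M. \<Lambda> f)"
    using GF1_finite GF1_card by (simp add: card_Diff_singleton_if)
  finally show ?case using Suc by (simp add: algebra_simps)
qed

lemma frob_GF2: "x \<in> GF 2 \<Longrightarrow> x ^ q \<in> GF 2" "x \<in> GF 2 \<Longrightarrow> (x ^ q) ^ q = x"
  by (rule GF_power) (auto simp: GF_iff power2_eq_square simp flip: power_mult)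

text \<open>As \<open>c\<close> is fixed by the square of the Frobenius map, the factors with even index are conjugates of
\<open>c - t\<close> and those with odd index are conjugates of \<open>(c ^ q - t) ^ q\<close>. The two products over conjugates
are norms to \<open>GF 2\<close>.\<close>

lemma orbit_poly_eval:
  assumes "c \<in> GF 2"
  shows "poly (orbit_poly (4 * k) t) c = ((c - t) * (c ^ q - t) ^ q) ^ norm_exponent k"
proof -
  define y where "y = (c - t) * (c ^ q - t) ^ q"
  have c: "c ^ (q ^ (2 * l)) = c" for l using GF_frob_mult[OF assms] .
  have "poly (orbit_poly (2 * j) t) c = y ^ (\<Sum>l<j. q ^ (2 * l))" for j
  proof (induction j)
    case (Suc j)
    have "poly (orbit_poly (2 * Suc j) t) c
        = poly (orbit_poly (2 * j) t) c * ((c - t ^ (q ^ (2 * j))) * (c - t ^ (q ^ (2 * j + 1))))"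
      by (simp add: orbit_poly_def poly_prod algebra_simps)
    also have "c - t ^ (q ^ (2 * j)) = (c - t) ^ (q ^ (2 * j))" by (simp add: frob_diff c)
    also have "c - t ^ (q ^ (2 * j + 1)) = ((c ^ q - t) ^ q) ^ (q ^ (2 * j))"
      using frob_diff[of "c ^ q" t 1] frob_diff[of c "t ^ q" "2 * j"] frob_GF2(2)[OF assms] c[of j]
        frob_frob[of t 1 "2 * j"] by simp
    also have "(c - t) ^ (q ^ (2 * j)) * ((c ^ q - t) ^ q) ^ (q ^ (2 * j)) = y ^ (q ^ (2 * j))"
      by (simp add: y_def power_mult_distrib)
    finally show ?case using Suc by (simp add: power_add)
  qed (simp add: orbit_poly_def)
  from this[of "2 * k"] have 1: "poly (orbit_poly (4 * k) t) c = y ^ (\<Sum>l<2 * k. q ^ (2 * l))" by simp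
  have "(\<Sum>l<j. q ^ (2 * l)) * (q\<^sup>2 - 1) = q ^ (2 * j) - 1" for j
  proof (induction j)
    case (Suc j)
    have "(q\<^sup>2 - 1) * q ^ (2 * j) + q ^ (2 * j) = q ^ (2 * Suc j)"
    proof -
      have "q\<^sup>2 - 1 + 1 = q\<^sup>2" using q2_gt by linarith
      then have "(q\<^sup>2 - 1) * q ^ (2 * j) + q ^ (2 * j) = q\<^sup>2 * q ^ (2 * j)"
        by (metis add_mult_distrib mult_1)
      then show ?thesis by (simp only: mult_Suc_right power_add)
    qed
    moreover have "(\<Sum>l<Suc j. q ^ (2 * l)) * (q\<^sup>2 - 1) = (q ^ (2 * j) - 1) + (q\<^sup>2 - 1) * q ^ (2 * j)"
      by (simp only: sum.lessThan_Suc add_mult_distrib Suc mult.commute[of "q ^ (2 * j)"])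
    moreover have "q ^ (2 * j) \<ge> 1" using q_gt_1 by simp
    ultimately show ?case by linarith
  qed simp
  from this[of "2 * k"] have "(\<Sum>l<2 * k. q ^ (2 * l)) * (q\<^sup>2 - 1) = norm_exponent k * (q\<^sup>2 - 1)"
    using norm_exponent_mult[of k] by simp
  moreover have "q\<^sup>2 - 1 \<noteq> 0" using q2_gt by linarith
  ultimately have "(\<Sum>l<2 * k. q ^ (2 * l)) = norm_exponent k" by (metis mult_right_cancel)
  then show ?thesis using 1 by (simp add: y_def)
qed

text \<open>A linear polynomial over the base field is determined by its value at \<open>c\<close>, because it also takes
the conjugate value at \<open>c ^ q\<close>.\<close>

lemma bij_eval_one:
  assumes "c \<in> GF 2" "c ^ q \<noteq> c"
  shows "bij_betw (\<lambda>r. poly r c) (polys_below 2) (GF 2)"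
proof -
  have inj: "inj_on (\<lambda>r. poly r c) (polys_below 2)"
  proof (rule inj_onI)
    fix r s assume r: "r \<in> polys_below 2" and s: "s \<in> polys_below 2" and eq: "poly r c = poly s c"
    have deg: "degree f < card {c, c ^ q}" if "f \<in> polys_below 2" for f
    proof -
      have "degree f \<le> 1" by (rule degree_le) (use that in \<open>auto simp: polys_below_def\<close>)
      then show ?thesis using assms(2) by (simp add: card_insert_if)
    qed
    have "poly f (c ^ q) = poly f c ^ q" if "f \<in> polys_below 2" for f
      using poly_base_frob[of f c 1] that by (simp add: polys_below_def)
    then show "r = s" using eq r s deg by (intro poly_eqI_degree[of "{c, c ^ q}"]) auto
  qed
  moreover have "(\<lambda>r. poly r c) ` polys_below 2 = GF 2"
    by (rule card_subset_eq)
       (use assms poly_base_GF finite_card_GF[of 2] card_image[OF inj] card_polys_below[of 2] in \<open>auto simp: polys_below_def\<close>)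
  ultimately show ?thesis by (simp add: bij_betw_def)
qed

text \<open>The Chinese remainder theorem for the minimal polynomials of \<open>c\<close> and \<open>e\<close>: a cubic polynomial over the
base field with given values at \<open>c\<close> and \<open>e\<close> has prescribed values at four points.\<close>

lemma bij_eval_two:
  assumes "c \<in> GF 2" "c ^ q \<noteq> c" "e \<in> GF 2" "e ^ q \<noteq> e" "c \<noteq> e" "c \<noteq> e ^ q"
  shows "bij_betw (\<lambda>r. (poly r c, poly r e)) (polys_below 4) (GF 2 \<times> GF 2)"
proof -
  have ne: "c ^ q \<noteq> e" "c ^ q \<noteq> e ^ q"
    using assms frob_GF2(2)[of c] frob_inj[of c 1 e] by auto
  have inj: "inj_on (\<lambda>r. (poly r c, poly r e)) (polys_below 4)"
  proof (rule inj_onI)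
    fix r s assume r: "r \<in> polys_below 4" and s: "s \<in> polys_below 4" and eq: "(poly r c, poly r e) = (poly s c, poly s e)"
    have deg: "degree f < card {c, c ^ q, e, e ^ q}" if "f \<in> polys_below 4" for f
    proof -
      have "degree f \<le> 3" by (rule degree_le) (use that in \<open>auto simp: polys_below_def\<close>)
      then show ?thesis using assms ne by (simp add: card_insert_if)
    qed
    have "poly f (x ^ q) = poly f x ^ q" if "f \<in> polys_below 4" for f x
      using poly_base_frob[of f x 1] that by (simp add: polys_below_def)
    then show "r = s" using eq r s deg by (intro poly_eqI_degree[of "{c, c ^ q, e, e ^ q}"]) auto
  qed
  moreover have "(\<lambda>r. (poly r c, poly r e)) ` polys_below 4 = GF 2 \<times> GF 2"
    by (rule card_subset_eq)
       (use assms poly_base_GF finite_card_GF[of 2] card_image[OF inj] card_polys_below[of 4] in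
         \<open>auto simp: polys_below_def card_cartesian_product simp flip: power_add\<close>)
  ultimately show ?thesis by (simp add: bij_betw_def)
qed

text \<open>The quadratic character of \<open>GF 2\<close>, given by Euler's criterion.\<close>

definition quad_char :: "'k \<Rightarrow> complex" where
  "quad_char x = (if x = 0 then 0 else if x ^ ((q\<^sup>2 - 1) div 2) = 1 then 1 else - 1)"

lemma sum_GF_shift:
  assumes "w \<in> GF n" shows "(\<Sum>a\<in>GF n. f (w + a)) = (\<Sum>a\<in>GF n. f a)"
proof (rule sum.reindex_bij_betw)
  show "bij_betw ((+) w) (GF n) (GF n)"
    by (rule bij_betwI[where g = "\<lambda>x. x - w"]) (use assms in \<open>auto intro: GF_add GF_diff\<close>)
qed

text \<open>Multiplication by \<open>u\<close> permutes the field and multiplies the sum by \<open>\<psi> u\<close>.\<close>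

lemma sum_character_zero:
  fixes \<psi> :: "'k \<Rightarrow> complex"
  assumes mult: "\<And>x y. x \<in> GF n \<Longrightarrow> y \<in> GF n \<Longrightarrow> \<psi> (x * y) = \<psi> x * \<psi> y"
    and u: "u \<in> GF n" "u \<noteq> 0" "\<psi> u \<noteq> 1"
  shows "(\<Sum>x\<in>GF n. \<psi> x) = 0"
proof -
  have "(\<Sum>x\<in>GF n. \<psi> (u * x)) = (\<Sum>x\<in>GF n. \<psi> x)"
  proof (rule sum.reindex_bij_betw)
    show "bij_betw ((*) u) (GF n) (GF n)"
      by (rule bij_betwI[where g = "\<lambda>x. x / u"]) (use u in \<open>auto intro: GF_mult GF_divide\<close>)
  qed
  moreover have "(\<Sum>x\<in>GF n. \<psi> (u * x)) = \<psi> u * (\<Sum>x\<in>GF n. \<psi> x)"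
    unfolding sum_distrib_left by (rule sum.cong) (use mult u in auto)
  ultimately have "(\<psi> u - 1) * (\<Sum>x\<in>GF n. \<psi> x) = 0" by (simp add: algebra_simps)
  then show ?thesis using u by simp
qed

end

locale odd_frobenius_closure = frobenius_closure q ty
  for q :: nat and ty :: "'k::alg_closed_field itself" +
  assumes odd_q: "odd q"
begin

lemma two_neq_0: "(2 :: 'k) \<noteq> 0"
proof
  assume "(2 :: 'k) = 0"
  then have "of_nat 2 = (0 :: 'k)" by simp
  then have "CHAR('k) dvd 2" using of_nat_eq_0_iff_char_dvd by blast
  then have "CHAR('k) = 2" using char_prime by (metis primes_dvd_imp_eq two_is_prime_nat)
  then show False using q_power odd_q by auto
qed

lemma one_neq_minus_one: "(1 :: 'k) \<noteq> - 1"
  using two_neq_0 by (metis add.right_inverse one_add_one)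

lemma even_q2: "2 * ((q\<^sup>2 - 1) div 2) = q\<^sup>2 - 1"
  using odd_q by simp

lemma GF_nonzero_power: "x \<in> GF n \<Longrightarrow> x \<noteq> 0 \<Longrightarrow> x ^ (q ^ n - 1) = 1"
proof -
  assume x: "x \<in> GF n" "x \<noteq> 0"
  have "q ^ n = Suc (q ^ n - 1)" using q_gt_1 by simp
  then have "x * x ^ (q ^ n - 1) = x * 1" using x unfolding GF_iff by (metis mult_1_right power_Suc)
  then show ?thesis using x by simp
qed

lemma half_power_cases:
  assumes "x \<in> GF 2" "x \<noteq> 0"
  shows "x ^ ((q\<^sup>2 - 1) div 2) = 1 \<or> x ^ ((q\<^sup>2 - 1) div 2) = - 1"
proof -
  have "(x ^ ((q\<^sup>2 - 1) div 2)) ^ 2 = x ^ (q\<^sup>2 - 1)"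
    using even_q2 by (simp only: power_mult[symmetric] mult.commute)
  then show ?thesis using GF_nonzero_power[OF assms] by (simp add: power2_eq_1_iff)
qed

lemma quad_char_mult:
  assumes "x \<in> GF 2" "y \<in> GF 2" shows "quad_char (x * y) = quad_char x * quad_char y"
proof (cases "x = 0 \<or> y = 0")
  case False
  define h where "h = (q\<^sup>2 - 1) div 2"
  have "(- 1 :: 'k) \<noteq> 1" using one_neq_minus_one by auto
  moreover have "x ^ h = 1 \<or> x ^ h = - 1" "y ^ h = 1 \<or> y ^ h = - 1"
    using half_power_cases assms False by (auto simp: h_def)
  ultimately show ?thesis
    using False unfolding quad_char_def h_def[symmetric] power_mult_distrib by auto
qed (auto simp: quad_char_def)

text \<open>Elements of the base field are squares in its quadratic extension.\<close>

lemma quad_char_base_field: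
  assumes "a \<in> GF 1" "a \<noteq> 0" shows "quad_char a = 1"
proof -
  obtain r where r: "q = 2 * r + 1" using odd_q by (rule oddE)
  have "q\<^sup>2 - 1 = 2 * ((q - 1) * (r + 1))" by (simp add: r power2_eq_square algebra_simps)
  then have "(q\<^sup>2 - 1) div 2 = (q - 1) * (r + 1)" by simp
  then have "a ^ ((q\<^sup>2 - 1) div 2) = (a ^ (q - 1)) ^ (r + 1)" by (simp only: power_mult)
  then show ?thesis using GF_nonzero_power[of a 1] assms by (simp add: quad_char_def)
qed

end

section \<open>The two L-functions of the conic sum\<close>

text \<open>The points \<open>c\<close> and \<open>e\<close> are quadratic over the base field and not conjugate to each other, and \<open>\<psi>\<close> is
a nontrivial character of \<open>GF 2\<close>.\<close>

locale conic_character = odd_frobenius_closure q ty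
  for q :: nat and ty :: "'k::alg_closed_field itself" +
  fixes c e :: 'k and \<psi> :: "'k \<Rightarrow> complex"
  assumes c: "c \<in> GF 2" "c ^ q \<noteq> c" and e: "e \<in> GF 2" "e ^ q \<noteq> e" and ce: "c \<noteq> e" "c \<noteq> e ^ q"
    and psi_0: "\<psi> 0 = 0" and psi_1: "\<psi> 1 = 1" and psi_le: "\<And>x. cmod (\<psi> x) \<le> 1"
    and psi_mult: "\<And>x y. x \<in> GF 2 \<Longrightarrow> y \<in> GF 2 \<Longrightarrow> \<psi> (x * y) = \<psi> x * \<psi> y"
    and psi_sum: "(\<Sum>x\<in>GF 2. \<psi> x) = 0"
begin

text \<open>The completely multiplicative functions whose L-functions have the sums \<open>T1\<close> and \<open>T2\<close> of the introduction
as linear coefficients: the value at \<open>X - t\<close> is \<open>\<psi> (c - t)\<close>, in the second case times the quadratic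
character of \<open>e - t\<close>.\<close>

definition plain_value :: "'k poly \<Rightarrow> complex" where "plain_value f = \<psi> (poly f c)"
definition twisted_value :: "'k poly \<Rightarrow> complex" where "twisted_value f = \<psi> (poly f c) * quad_char (poly f e)"

lemma plain_value_mult: "base_poly f \<Longrightarrow> base_poly g \<Longrightarrow> plain_value (f * g) = plain_value f * plain_value g"
  using c poly_base_GF by (simp add: plain_value_def psi_mult)

lemma twisted_value_mult: "base_poly f \<Longrightarrow> base_poly g \<Longrightarrow> twisted_value (f * g) = twisted_value f * twisted_value g"
  using c e poly_base_GF by (simp add: twisted_value_def psi_mult quad_char_mult)

lemma quad_char_1: "quad_char 1 = 1" by (simp add: quad_char_def)

lemma values_at_1: "plain_value 1 = 1" "twisted_value 1 = 1"
  by (simp_all add: plain_value_def twisted_value_def psi_1 quad_char_1)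

lemma eval_monic_part_in_GF2:
  assumes "h \<in> monics n" "x \<in> GF 2" shows "x ^ M * poly h x \<in> GF 2"
  using assms by (auto simp: monics_def intro!: GF_mult GF_power poly_base_GF)

text \<open>The lower part of a monic polynomial of degree at least 2 moves its value at \<open>c\<close> through the whole of
\<open>GF 2\<close>, where \<open>\<psi>\<close> sums to zero.\<close>

lemma plain_value_sum_zero:
  assumes "n \<ge> 2" shows "(\<Sum>f\<in>monics n. plain_value f) = 0"
proof (rule sum_monics_split[OF _ assms])
  fix h assume h: "h \<in> monics (n - 2)"
  have "(\<Sum>r\<in>polys_below 2. plain_value (monom 1 2 * h + r)) = (\<Sum>r\<in>polys_below 2. \<psi> (c ^ 2 * poly h c + poly r c))"
    by (simp add: plain_value_def poly_monom)
  also have "\<dots> = (\<Sum>a\<in>GF 2. \<psi> (c ^ 2 * poly h c + a))"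
    by (rule sum.reindex_bij_betw[OF bij_eval_one[OF c]])
  also have "\<dots> = 0" using sum_GF_shift[OF eval_monic_part_in_GF2[OF h c(1), of 2], of \<psi>] psi_sum by simp
  finally show "(\<Sum>r\<in>polys_below 2. plain_value (monom 1 2 * h + r)) = 0" .
qed

lemma twisted_value_sum_zero:
  assumes "n \<ge> 4" shows "(\<Sum>f\<in>monics n. twisted_value f) = 0"
proof (rule sum_monics_split[OF _ assms])
  fix h assume h: "h \<in> monics (n - 4)"
  let ?w = "c ^ 4 * poly h c" and ?v = "e ^ 4 * poly h e"
  have "(\<Sum>r\<in>polys_below 4. twisted_value (monom 1 4 * h + r))
      = (\<Sum>r\<in>polys_below 4. (case (poly r c, poly r e) of (a, b) \<Rightarrow> \<psi> (?w + a) * quad_char (?v + b)))"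
    by (simp add: twisted_value_def poly_monom)
  also have "\<dots> = (\<Sum>(a, b)\<in>GF 2 \<times> GF 2. \<psi> (?w + a) * quad_char (?v + b))"
    by (rule sum.reindex_bij_betw[OF bij_eval_two[OF c e ce]])
  also have "\<dots> = (\<Sum>a\<in>GF 2. \<psi> (?w + a)) * (\<Sum>b\<in>GF 2. quad_char (?v + b))"
    by (simp only: sum_product sum.cartesian_product)
  also have "(\<Sum>a\<in>GF 2. \<psi> (?w + a)) = 0"
    using sum_GF_shift[OF eval_monic_part_in_GF2[OF h c(1), of 4], of \<psi>] psi_sum by simp
  finally show "(\<Sum>r\<in>polys_below 4. twisted_value (monom 1 4 * h + r)) = 0" by simp
qed

text \<open>Constant factors from the base field do not change the values of the two characters, so both sums are, up
to the factor \<open>q - 1\<close>, sums over a full residue system, on which the evaluations at \<open>c\<close> and \<open>e\<close> are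
bijective.\<close>

lemma value_sums_at_one:
  assumes triv: "\<And>a. a \<in> GF 1 \<Longrightarrow> a \<noteq> 0 \<Longrightarrow> \<psi> a = 1"
  shows "(\<Sum>n<2. \<Sum>f\<in>monics n. plain_value f) = 0" "(\<Sum>n<4. \<Sum>f\<in>monics n. twisted_value f) = 0"
proof -
  have sub: "GF 1 \<subseteq> GF 2" by (rule GF_mono) simp
  have q0: "of_nat (q - 1) \<noteq> (0 :: complex)" using q_gt_1 by simp
  have 1: "plain_value (smult a f) = plain_value f" if "a \<in> GF 1" "a \<noteq> 0" "base_poly f" for a f
    using that sub triv c poly_base_GF by (auto simp: plain_value_def psi_mult subsetD)
  have 2: "twisted_value (smult a f) = twisted_value f" if "a \<in> GF 1" "a \<noteq> 0" "base_poly f" for a f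
    using that sub triv c e poly_base_GF quad_char_base_field by (auto simp: twisted_value_def psi_mult quad_char_mult subsetD)
  have "(\<Sum>r\<in>polys_below 2. plain_value r) = (\<Sum>a\<in>GF 2. \<psi> a)"
    unfolding plain_value_def by (rule sum.reindex_bij_betw[OF bij_eval_one[OF c]])
  then show "(\<Sum>n<2. \<Sum>f\<in>monics n. plain_value f) = 0"
    using sum_polys_below_scaling[of plain_value 2, OF _ 1] psi_0 psi_sum q0 by (simp add: plain_value_def)
  have "(\<Sum>r\<in>polys_below 4. twisted_value r) = (\<Sum>r\<in>polys_below 4. (case (poly r c, poly r e) of (a, b) \<Rightarrow> \<psi> a * quad_char b))"
    by (simp add: twisted_value_def)
  also have "\<dots> = (\<Sum>(a, b)\<in>GF 2 \<times> GF 2. \<psi> a * quad_char b)"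
    by (rule sum.reindex_bij_betw[OF bij_eval_two[OF c e ce]])
  also have "\<dots> = (\<Sum>a\<in>GF 2. \<psi> a) * (\<Sum>b\<in>GF 2. quad_char b)"
    by (simp only: sum_product sum.cartesian_product)
  finally have "(\<Sum>r\<in>polys_below 4. twisted_value r) = 0" using psi_sum by simp
  moreover have "(\<Sum>r\<in>polys_below 4. twisted_value r) = of_nat (q - 1) * (\<Sum>n<4. \<Sum>f\<in>monics n. twisted_value f)"
    by (rule sum_polys_below_scaling) (use psi_0 2 in \<open>auto simp: twisted_value_def\<close>)
  ultimately show "(\<Sum>n<4. \<Sum>f\<in>monics n. twisted_value f) = 0" using q0 by simp
qed

text \<open>The left-hand side counts the square roots of the norm of \<open>(e - t) * (e ^ q - t) ^ q\<close> in \<open>GF 2\<close>. An element of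
\<open>GF (4 * k)\<close> is a square if and only if its norm is, and \<open>(e - t) * (e ^ q - t) ^ q\<close> differs from
\<open>(t - e) / (t - e ^ q)\<close> by the factor \<open>(e ^ q - t) ^ (q + 1)\<close>, which is a square as \<open>q\<close> is odd.\<close>

lemma one_plus_quad_char:
  assumes k: "k > 0" and t: "t \<in> GF (4 * k)" "t \<noteq> e" "t \<noteq> e ^ q"
  shows "1 + quad_char (poly (orbit_poly (4 * k) t) e) = of_nat (card {s \<in> GF (4 * k). s\<^sup>2 = (t - e) / (t - e ^ q)})"
proof -
  define w where "w = (t - e) / (t - e ^ q)"
  define y where "y = (e - t) * (e ^ q - t) ^ q"
  define h where "h = (q\<^sup>2 - 1) div 2"
  define H where "H = norm_exponent k * h"
  have sub: "GF 2 \<subseteq> GF (4 * k)" by (rule GF_mono) simp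
  have eK: "e \<in> GF (4 * k)" "e ^ q \<in> GF (4 * k)" using e sub frob_GF2 by auto
  have H: "2 * H = q ^ (4 * k) - 1"
  proof -
    have "2 * H = norm_exponent k * (2 * h)" by (simp add: H_def)
    then show ?thesis using norm_exponent_mult[of k] even_q2 by (simp only: h_def)
  qed
  have w0: "w \<noteq> 0" and wK: "w \<in> GF (4 * k)" using t eK by (auto simp: w_def intro!: GF_divide GF_diff)
  define u where "u = e ^ q - t"
  have u: "u \<in> GF (4 * k)" "u \<noteq> 0" using t eK by (auto simp: u_def intro!: GF_diff)
  have "y = w * u ^ (q + 1)" using t by (simp add: y_def w_def u_def field_simps)
  moreover have "(u ^ (q + 1)) ^ H = 1"
  proof -
    obtain r where r: "q = 2 * r + 1" using odd_q by (rule oddE)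
    have "(q + 1) * H = (2 * H) * (r + 1)" by (simp add: r algebra_simps)
    then have "(u ^ (q + 1)) ^ H = (u ^ (q ^ (4 * k) - 1)) ^ (r + 1)"
      by (metis power_mult H)
    then show ?thesis using GF_nonzero_power[OF u] by simp
  qed
  ultimately have yH: "y ^ H = w ^ H" and y0: "y \<noteq> 0" using w0 u by (auto simp: power_mult_distrib)
  have ev: "poly (orbit_poly (4 * k) t) e = y ^ norm_exponent k" using orbit_poly_eval[OF e(1)] by (simp add: y_def)
  have eta: "quad_char (poly (orbit_poly (4 * k) t) e) = (if w ^ H = 1 then 1 else - 1)"
    using y0 yH unfolding ev quad_char_def by (simp add: H_def h_def power_mult)
  obtain s where s: "s ^ 2 = w" using nth_root_exists[of 2 w] by auto
  have s0: "s \<noteq> 0" using s w0 by auto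
  have "s ^ (q ^ (4 * k)) = s * w ^ H"
  proof -
    have "q ^ (4 * k) = Suc (2 * H)" using H q_gt_1 by simp
    then show ?thesis using s by (simp add: power_mult)
  qed
  then have sK: "s \<in> GF (4 * k) \<longleftrightarrow> w ^ H = 1" using s0 by (simp add: GF_iff)
  have ss: "{s' \<in> GF (4 * k). s'\<^sup>2 = w} = (if w ^ H = 1 then {s, - s} else {})"
    using sK s by (auto simp: power2_eq_iff intro: GF_minus) (metis GF_minus add.inverse_inverse)+
  have "s \<noteq> - s" using s0 two_neq_0 by (metis add_eq_0_iff2 mult_2 mult_eq_0_iff)
  then show ?thesis unfolding eta w_def[symmetric] ss by simp
qed

end

section \<open>The Riemann hypothesis for the two L-functions\<close>

context conic_character
begin

text \<open>By \<open>one_plus_quad_char\<close> the combined sum runs over the points \<open>s\<close> of the double cover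
\<open>s\<^sup>2 = (t - e) / (t - e ^ q)\<close>, apart from the branch points \<open>t = e\<close> and \<open>t = e ^ q\<close>. Solving for \<open>t\<close>
gives \<open>t = (e - e ^ q * s\<^sup>2) / (1 - s\<^sup>2)\<close>, so that \<open>c - t\<close> and \<open>c ^ q - t\<close> become quadratic
polynomials in \<open>s\<close> divided by \<open>1 - s\<^sup>2\<close>. The zeros of the first of them are simple, and no zero of the
other factors of \<open>g\<close>.\<close>

lemma combined_sum_bound:
  "\<exists>C k0. \<forall>k\<ge>k0. cmod ((\<Sum>t\<in>GF (4 * k). plain_value (orbit_poly (4 * k) t)) + (\<Sum>t\<in>GF (4 * k). twisted_value (orbit_poly (4 * k) t)))
     \<le> C * real q ^ (2 * k)"
proof -
  define c' e' where "c' = c ^ q" and "e' = e ^ q"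
  have GF2: "c' \<in> GF 2" "e' \<in> GF 2" using c e frob_GF2(1) by (auto simp: c'_def e'_def)
  have ne: "c \<noteq> c'" "e \<noteq> e'" "c \<noteq> e" "c \<noteq> e'" using c e ce by (auto simp: c'_def e'_def)
  \<comment> \<open>The points \<open>\<plusminus> x0\<close> of the double cover lie over \<open>t = c\<close>.\<close>
  obtain x0 where x0: "x0 ^ 2 = (c - e) / (c - e')" using nth_root_exists[of 2 "(c - e) / (c - e')"] by auto
  have x0n: "x0 \<noteq> 0" using x0 ne by auto
  have x0_4: "x0 \<in> GF 4"
  proof -
    have "(x0 ^ (q ^ 2)) ^ 2 = ((c - e) / (c - e')) ^ (q ^ 2)"
      unfolding x0[symmetric] by (simp add: mult.commute flip: power_mult)
    also have "\<dots> = x0 ^ 2" using GF_divide[OF GF_diff GF_diff] c e GF2 x0 by (simp add: GF_iff)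
    finally have "x0 ^ (q ^ 2) = x0 \<or> x0 ^ (q ^ 2) = - x0" by (simp only: power2_eq_iff)
    then have "(x0 ^ (q ^ 2)) ^ (q ^ 2) = x0" using frob_minus[of x0 2] by auto
    then show ?thesis using frob_frob[of x0 2 2] by (simp add: GF_iff)
  qed
  define D where "D = q\<^sup>2 - 1"
  \<comment> \<open>This exponent turns a denominator \<open>1 - s\<^sup>2\<close> into a factor of \<open>g\<close>: in total a power \<open>D * (q + 1)\<close> of \<open>1 - s\<^sup>2\<close> has been inserted, whose norm is 1.\<close>
  define N where "N = (D - 1) * (q + 1)"
  have D3: "D \<ge> 3" using q2_gt by (simp add: D_def)
  have N: "q + 1 + N = D * (q + 1)" "N > 0" using D3 unfolding N_def by (cases D; simp)+
  define B where "B = [:c' - e, 0, -(c' - e'):]"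
  define E where "E = [:1, 0, - 1 :: 'k:]"
  define g0 where "g0 = smult (-(c - e')) [:x0, 1:] * (B ^ q * E ^ N)"
  define g where "g = [:-x0, 1:] * g0"
  have "[:-x0, 1:] * smult (-(c - e')) [:x0, 1:] = [:c - e, 0, -(c - e'):]"
    using x0 ne by (simp add: power2_eq_square field_simps)
  then have g_eq: "g = [:c - e, 0, -(c - e'):] * (B ^ q * E ^ N)"
    unfolding g_def g0_def by (simp only: mult.assoc[symmetric])
  have sub24: "GF 2 \<subseteq> GF 4" by (rule GF_mono) simp
  have over: "poly_over 4 [:a, b, d:]" if "a \<in> GF 4" "b \<in> GF 4" "d \<in> GF 4" for a b d
    using that by (simp add: poly_over_def coeff_pCons split: nat.splits)
  have in4: "c \<in> GF 4" "e \<in> GF 4" "c' \<in> GF 4" "e' \<in> GF 4" using c e GF2 sub24 by auto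
  have "poly_over 4 B" "poly_over 4 E" unfolding B_def E_def
    by (intro over GF_diff GF_minus in4 GF_0 GF_1)+
  then have g0_over: "poly_over 4 g0" unfolding g0_def
    by (intro poly_over_mult poly_over_power poly_over_smult poly_over_linear GF_minus GF_diff in4 x0_4 GF_1)
  have "poly g0 x0 \<noteq> 0"
  proof -
    have "x0 + x0 \<noteq> 0" using x0n two_neq_0 by (simp flip: mult_2)
    moreover have "poly B x0 = (c - c') * (e' - e) / (c - e')"
    proof -
      have "poly B x0 = c' - e - (c' - e') * x0 ^ 2" by (simp add: B_def power2_eq_square algebra_simps)
      also have "\<dots> = (c - c') * (e' - e) / (c - e')" unfolding x0 using ne by (simp add: field_simps)
      finally show ?thesis .
    qed
    moreover have "poly E x0 = (e - e') / (c - e')"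
      using x0 ne by (simp add: E_def power2_eq_square field_simps)
    ultimately show ?thesis using ne by (simp add: g0_def)
  qed
  from nontrivial_character_sum_bound[OF psi_0 psi_sum psi_le x0_4 g0_over this g_def]
  obtain C k0 where bound: "\<And>k. k \<ge> k0 \<Longrightarrow> cmod (\<Sum>x\<in>GF (4 * k). \<psi> (poly g x ^ norm_exponent k)) \<le> C * real q ^ (2 * k)"
    by blast
  have "cmod ((\<Sum>t\<in>GF (4 * k). plain_value (orbit_poly (4 * k) t)) + (\<Sum>t\<in>GF (4 * k). twisted_value (orbit_poly (4 * k) t)))
     \<le> (C + 3) * real q ^ (2 * k)" if k: "k \<ge> max 1 k0" for k
  proof -
    have k1: "k > 0" "k \<ge> k0" using k by auto
    define K where "K = GF (4 * k)"
    have fin: "finite K" using finite_card_GF[of "4 * k"] k1 by (simp add: K_def)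
    have sub: "GF 2 \<subseteq> K" unfolding K_def by (rule GF_mono) simp
    have inK: "c \<in> K" "e \<in> K" "c' \<in> K" "e' \<in> K" using c e GF2 sub by auto
    have nx: "norm_exponent k > 0" using norm_exponent_pos k1 by simp
    define y where "y = (\<lambda>t. (c - t) * (c' - t) ^ q)"
    define F where "F = (\<lambda>t. \<psi> (y t ^ norm_exponent k) * (1 + quad_char (poly (orbit_poly (4 * k) t) e)))"
    have eq: "(\<Sum>t\<in>GF (4 * k). plain_value (orbit_poly (4 * k) t)) + (\<Sum>t\<in>GF (4 * k). twisted_value (orbit_poly (4 * k) t)) = (\<Sum>t\<in>K. F t)"
      by (simp add: F_def K_def plain_value_def twisted_value_def orbit_poly_eval[OF c(1)] y_def c'_def sum.distrib distrib_left)
    define T where "T = K - {e, e'}"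
    have split: "(\<Sum>t\<in>K. F t) = F e + F e' + (\<Sum>t\<in>T. F t)"
    proof -
      have "(\<Sum>t\<in>K. F t) = (\<Sum>t\<in>T. F t) + (\<Sum>t\<in>{e, e'}. F t)"
        unfolding T_def by (rule sum.subset_diff) (use fin inK in auto)
      then show ?thesis using ne by simp
    qed
    \<comment> \<open>At the two branch points of the double cover the quadratic character vanishes; they contribute a bounded amount.\<close>
    have small: "cmod (F t) \<le> 1" if "t = e \<or> t = e'" for t
    proof -
      have "poly (orbit_poly (4 * k) t) e = 0"
        unfolding orbit_poly_eval[OF e(1)] using that nx q_gt_1 by (auto simp: e'_def)
      then show ?thesis using psi_le by (simp add: F_def quad_char_def)
    qed
    define S where "S = {s \<in> K. s \<noteq> 0 \<and> s\<^sup>2 \<noteq> 1}"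
    define \<tau> where "\<tau> = (\<lambda>s. (e - e' * s\<^sup>2) / (1 - s\<^sup>2))"
    have finS: "finite S" using fin by (simp add: S_def)
    have tau: "\<tau> s - e = (e - e') * s\<^sup>2 / (1 - s\<^sup>2)" "\<tau> s - e' = (e - e') / (1 - s\<^sup>2)" if "s \<in> S" for s
    proof -
      have "1 - s\<^sup>2 \<noteq> 0" using that by (auto simp: S_def)
      then show "\<tau> s - e = (e - e') * s\<^sup>2 / (1 - s\<^sup>2)" "\<tau> s - e' = (e - e') / (1 - s\<^sup>2)"
        by (auto simp: \<tau>_def field_simps)
    qed
    have tauT: "\<tau> s \<in> T" if "s \<in> S" for s
    proof -
      have "1 - s\<^sup>2 \<noteq> 0" "s \<noteq> 0" using that by (auto simp: S_def)
      then have "\<tau> s - e \<noteq> 0" "\<tau> s - e' \<noteq> 0" using tau[OF that] ne by auto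
      moreover have "\<tau> s \<in> K" using that inK unfolding \<tau>_def S_def K_def
        by (intro GF_divide GF_diff GF_mult GF_power GF_1) auto
      ultimately show ?thesis by (auto simp: T_def)
    qed
    have fibre: "{s \<in> S. \<tau> s = t} = {s \<in> K. s\<^sup>2 = (t - e) / (t - e')}" if t: "t \<in> T" for t
    proof (intro equalityI subsetI)
      fix s assume s: "s \<in> {s \<in> S. \<tau> s = t}"
      then have "1 - s\<^sup>2 \<noteq> 0" by (auto simp: S_def)
      then have "s\<^sup>2 = (\<tau> s - e) / (\<tau> s - e')" using tau[of s] s ne by auto
      then show "s \<in> {s \<in> K. s\<^sup>2 = (t - e) / (t - e')}" using s by (auto simp: S_def)
    next
      fix s assume s: "s \<in> {s \<in> K. s\<^sup>2 = (t - e) / (t - e')}"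
      have t': "t - e \<noteq> 0" "t - e' \<noteq> 0" using t by (auto simp: T_def)
      have "s\<^sup>2 \<noteq> 0" using s t' by auto
      moreover have 1: "1 - s\<^sup>2 = (e - e') / (t - e')" using s t' by (auto simp: field_simps)
      then have "s\<^sup>2 \<noteq> 1" using ne t' by auto
      moreover have "\<tau> s = t"
      proof -
        have "e - e' * ((t - e) / (t - e')) = t * (e - e') / (t - e')" using t' by (simp add: field_simps)
        then have "e - e' * s\<^sup>2 = t * (e - e') / (t - e')" using s by simp
        then show ?thesis unfolding \<tau>_def 1 using ne t' by simp
      qed
      ultimately show "s \<in> {s \<in> S. \<tau> s = t}" using s by (auto simp: S_def)
    qed
    have "(\<Sum>t\<in>T. F t) = (\<Sum>t\<in>T. \<Sum>s | s \<in> S \<and> \<tau> s = t. \<psi> (y (\<tau> s) ^ norm_exponent k))"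
    proof (rule sum.cong)
      fix t assume t: "t \<in> T"
      have "F t = \<psi> (y t ^ norm_exponent k) * of_nat (card {s \<in> S. \<tau> s = t})"
        unfolding F_def fibre[OF t] using one_plus_quad_char[OF k1(1), of t] t by (simp add: T_def K_def e'_def)
      also have "\<dots> = (\<Sum>s | s \<in> S \<and> \<tau> s = t. \<psi> (y (\<tau> s) ^ norm_exponent k))"
        by (simp add: mult.commute)
      finally show "F t = (\<Sum>s | s \<in> S \<and> \<tau> s = t. \<psi> (y (\<tau> s) ^ norm_exponent k))" .
    qed simp
    also have "\<dots> = (\<Sum>s\<in>S. \<psi> (y (\<tau> s) ^ norm_exponent k))"
      by (rule sum.group[OF finS]) (use fin tauT in \<open>auto simp: T_def\<close>)
    also have "\<dots> = (\<Sum>s\<in>S. \<psi> (poly g s ^ norm_exponent k))"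
    proof (rule sum.cong)
      fix s assume s: "s \<in> S"
      define d where "d = 1 - s\<^sup>2"
      have d: "d \<noteq> 0" "d \<in> GF (4 * k)" using s by (auto simp: d_def S_def K_def intro!: GF_diff GF_power)
      have A: "c - e - (c - e') * s\<^sup>2 = (c - \<tau> s) * d" "c' - e - (c' - e') * s\<^sup>2 = (c' - \<tau> s) * d"
        using d(1) by (simp_all add: \<tau>_def d_def field_simps)
      have "poly g s = (c - e - (c - e') * s\<^sup>2) * ((c' - e - (c' - e') * s\<^sup>2) ^ q * d ^ N)"
        by (simp add: g_eq B_def E_def d_def power2_eq_square algebra_simps)
      also have "\<dots> = y (\<tau> s) * d ^ (q + 1 + N)"
        unfolding A by (simp add: y_def power_mult_distrib power_add mult_ac)
      finally have "poly g s ^ norm_exponent k = y (\<tau> s) ^ norm_exponent k * (d ^ (norm_exponent k * D)) ^ (q + 1)"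
        unfolding N by (simp only: power_mult_distrib power_mult[symmetric] mult_ac)
      also have "d ^ (norm_exponent k * D) = 1"
        using GF_nonzero_power[OF d(2,1)] norm_exponent_mult[of k] by (simp only: D_def)
      finally show "\<psi> (y (\<tau> s) ^ norm_exponent k) = \<psi> (poly g s ^ norm_exponent k)" by simp
    qed simp
    also have "\<dots> = (\<Sum>s\<in>K. \<psi> (poly g s ^ norm_exponent k)) - \<psi> (poly g 0 ^ norm_exponent k)"
    proof -
      have "(\<Sum>s\<in>K. \<psi> (poly g s ^ norm_exponent k)) = (\<Sum>s\<in>insert 0 S. \<psi> (poly g s ^ norm_exponent k))"
      proof (rule sum.mono_neutral_right)
        show "insert 0 S \<subseteq> K" by (auto simp: S_def K_def)
        show "\<forall>s\<in>K - insert 0 S. \<psi> (poly g s ^ norm_exponent k) = 0"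
        proof
          fix s assume "s \<in> K - insert 0 S"
          then have "poly E s = 0" by (auto simp: S_def E_def power2_eq_square)
          then have "poly g s = 0" by (simp add: g_eq zero_power[OF N(2)])
          then show "\<psi> (poly g s ^ norm_exponent k) = 0" using psi_0 by (simp add: zero_power[OF nx])
        qed
      qed (use fin in auto)
      moreover have "0 \<notin> S" by (simp add: S_def)
      ultimately show ?thesis using finS by simp
    qed
    finally have T: "(\<Sum>t\<in>T. F t) = (\<Sum>s\<in>K. \<psi> (poly g s ^ norm_exponent k)) - \<psi> (poly g 0 ^ norm_exponent k)" .
    have "cmod (\<Sum>t\<in>T. F t) \<le> C * real q ^ (2 * k) + 1"
      unfolding T using bound[OF k1(2)] psi_le[of "poly g 0 ^ norm_exponent k"] norm_triangle_ineq4 unfolding K_def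
      by (meson add_mono order_trans)
    moreover have "cmod (F e + F e') \<le> 2" using norm_triangle_ineq[of "F e" "F e'"] small[of e] small[of e'] by simp
    ultimately have "cmod (\<Sum>t\<in>K. F t) \<le> C * real q ^ (2 * k) + 3"
      unfolding split using norm_triangle_ineq[of "F e + F e'" "\<Sum>t\<in>T. F t"] by linarith
    moreover have "real q ^ (2 * k) \<ge> 1" using q_gt_1 by (intro one_le_power) simp
    ultimately show ?thesis unfolding eq by (simp add: algebra_simps)
  qed
  then show ?thesis by blast
qed

text \<open>The two L-functions are estimated together: the bound for the sum of their power sums controls the
inverse roots of both. Only orders divisible by 4 are at hand, so the estimate is applied to the
fourth powers of the inverse roots.\<close>

lemma root_bounds:
  obtains as bs :: "complex list" where "length as < 2" "length bs < 4"
    "(\<Sum>t\<in>GF 1. \<psi> (c - t)) = - sum_list as"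
    "(\<Sum>t\<in>GF 1. \<psi> (c - t) * quad_char (e - t)) = - sum_list bs"
    "\<And>a. a \<in> set as \<union> set bs \<Longrightarrow> cmod a \<le> sqrt (real q)"
    "(\<And>a. a \<in> GF 1 \<Longrightarrow> a \<noteq> 0 \<Longrightarrow> \<psi> a = 1) \<Longrightarrow> 1 \<in> set as \<and> 1 \<in> set bs"
proof -
  obtain as where as: "length as < 2"
      "\<And>n. n \<ge> 1 \<Longrightarrow> (\<Sum>t\<in>GF n. plain_value (orbit_poly n t)) = - (\<Sum>a\<leftarrow>as. a ^ n)"
      "(\<Sum>i<2. \<Sum>f\<in>monics i. plain_value f) = 0 \<Longrightarrow> 1 \<in> set as"
    using L_function_roots[of plain_value 2, OF plain_value_mult values_at_1(1) plain_value_sum_zero] by blast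
  obtain bs where bs: "length bs < 4"
      "\<And>n. n \<ge> 1 \<Longrightarrow> (\<Sum>t\<in>GF n. twisted_value (orbit_poly n t)) = - (\<Sum>a\<leftarrow>bs. a ^ n)"
      "(\<Sum>i<4. \<Sum>f\<in>monics i. twisted_value f) = 0 \<Longrightarrow> 1 \<in> set bs"
    using L_function_roots[of twisted_value 4, OF twisted_value_mult values_at_1(2) twisted_value_sum_zero] by blast
  obtain C k0 where C: "\<And>k. k \<ge> k0 \<Longrightarrow> cmod ((\<Sum>t\<in>GF (4 * k). plain_value (orbit_poly (4 * k) t)) + (\<Sum>t\<in>GF (4 * k). twisted_value (orbit_poly (4 * k) t)))
     \<le> C * real q ^ (2 * k)" using combined_sum_bound by blast
  let ?cs = "map (\<lambda>a. a ^ 4) (as @ bs)"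
  have "cmod (\<Sum>a\<leftarrow>?cs. a ^ k) \<le> C * (real q ^ 2) ^ k" if k: "k \<ge> max 1 k0" for k
  proof -
    have "(\<Sum>a\<leftarrow>?cs. a ^ k) = (\<Sum>a\<leftarrow>as. a ^ (4 * k)) + (\<Sum>a\<leftarrow>bs. a ^ (4 * k))"
      by (simp add: o_def power_mult)
    also have "\<dots> = - ((\<Sum>t\<in>GF (4 * k). plain_value (orbit_poly (4 * k) t)) + (\<Sum>t\<in>GF (4 * k). twisted_value (orbit_poly (4 * k) t)))"
      using as(2)[of "4 * k"] bs(2)[of "4 * k"] k by simp
    finally show ?thesis using C[of k] k by (simp only: norm_minus_cancel power_mult max.bounded_iff)
  qed
  then have R: "cmod x \<le> real q ^ 2" if "x \<in> set ?cs" for x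
    using power_sum_bound[of "max 1 k0" ?cs C "real q ^ 2" x] that q_gt_1 by simp
  have "cmod a \<le> sqrt (real q)" if "a \<in> set as \<union> set bs" for a
  proof -
    have "cmod (a ^ 4) \<le> real q ^ 2" using R that by auto
    moreover have "(sqrt (real q)) ^ 4 = ((sqrt (real q)) ^ 2) ^ 2"
      using power_mult[of "sqrt (real q)" 2 2] by simp
    ultimately have "(cmod a) ^ 4 \<le> (sqrt (real q)) ^ 4" by (simp add: norm_power)
    then show ?thesis using power_mono_iff[of "cmod a" "sqrt (real q)" 4] by simp
  qed
  moreover have "(\<Sum>t\<in>GF 1. \<psi> (c - t)) = - sum_list as"
    using as(2)[of 1] by (simp add: orbit_poly_1[simplified] plain_value_def)
  moreover have "(\<Sum>t\<in>GF 1. \<psi> (c - t) * quad_char (e - t)) = - sum_list bs"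
    using bs(2)[of 1] by (simp add: orbit_poly_1[simplified] twisted_value_def)
  ultimately show ?thesis
    using that[of as bs] as bs value_sums_at_one by blast
qed

lemma norm_sum_list_le:
  assumes "\<And>x. x \<in> set xs \<Longrightarrow> cmod x \<le> r" "length xs \<le> n" "0 \<le> r"
  shows "cmod (sum_list xs) \<le> real n * r"
proof -
  have "cmod (sum_list xs) \<le> real (length xs) * r"
    using assms(1)
  proof (induction xs)
    case (Cons x xs)
    then have "cmod x \<le> r" "cmod (sum_list xs) \<le> real (length xs) * r" by auto
    then show ?case using norm_triangle_ineq[of x "sum_list xs"] by (simp add: algebra_simps)
  qed simp
  also have "\<dots> \<le> real n * r" using assms(2,3) by (intro mult_right_mono) auto
  finally show ?thesis .
qed

text \<open>In the second case the inverse root 1 of the first L-function cancels against one of at most three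
inverse roots of the second.\<close>

theorem conic_bound:
  "cmod (\<Sum>t\<in>GF 1. \<psi> (c - t) * (1 - quad_char (e - t))) \<le> 4 * sqrt (real q)"
  "(\<And>a. a \<in> GF 1 \<Longrightarrow> a \<noteq> 0 \<Longrightarrow> \<psi> a = 1) \<Longrightarrow>
    cmod (\<Sum>t\<in>GF 1. \<psi> (c - t) * (1 - quad_char (e - t))) \<le> 2 * sqrt (real q)"
proof -
  obtain as bs where r: "length as < 2" "length bs < 4"
    "(\<Sum>t\<in>GF 1. \<psi> (c - t)) = - sum_list as"
    "(\<Sum>t\<in>GF 1. \<psi> (c - t) * quad_char (e - t)) = - sum_list bs"
    "\<And>a. a \<in> set as \<union> set bs \<Longrightarrow> cmod a \<le> sqrt (real q)"
    "(\<And>a. a \<in> GF 1 \<Longrightarrow> a \<noteq> 0 \<Longrightarrow> \<psi> a = 1) \<Longrightarrow> 1 \<in> set as \<and> 1 \<in> set bs"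
    using root_bounds by blast
  have S: "(\<Sum>t\<in>GF 1. \<psi> (c - t) * (1 - quad_char (e - t))) = sum_list bs - sum_list as"
    using r(3,4) by (simp add: right_diff_distrib sum_subtractf)
  have "cmod (sum_list as) \<le> 1 * sqrt (real q)"
    using norm_sum_list_le[of as "sqrt (real q)" 1] r(1,5) by simp
  moreover have "cmod (sum_list bs) \<le> 3 * sqrt (real q)"
    using norm_sum_list_le[of bs "sqrt (real q)" 3] r(2,5) by simp
  ultimately show "cmod (\<Sum>t\<in>GF 1. \<psi> (c - t) * (1 - quad_char (e - t))) \<le> 4 * sqrt (real q)"
    unfolding S using norm_triangle_ineq4[of "sum_list bs" "sum_list as"] by simp
  assume "\<And>a. a \<in> GF 1 \<Longrightarrow> a \<noteq> 0 \<Longrightarrow> \<psi> a = 1"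
  then have one: "1 \<in> set as" "1 \<in> set bs" using r(6) by auto
  have "as = [1]" using one(1) r(1) by (cases as) auto
  moreover have "sum_list bs = 1 + sum_list (remove1 1 bs)" using sum_list_map_remove1[OF one(2), of "\<lambda>x. x"] by simp
  moreover have "cmod (sum_list (remove1 1 bs)) \<le> 2 * sqrt (real q)"
  proof -
    have "cmod x \<le> sqrt (real q)" if "x \<in> set (remove1 1 bs)" for x
      using r(5) set_remove1_subset[of 1 bs] that by blast
    then show ?thesis
      using norm_sum_list_le[of "remove1 1 bs" "sqrt (real q)" 2] r(2) one(2) by (simp add: length_remove1)
  qed
  ultimately show "cmod (\<Sum>t\<in>GF 1. \<psi> (c - t) * (1 - quad_char (e - t))) \<le> 2 * sqrt (real q)"
    unfolding S by simp
qed

end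

section \<open>From the conic to the affine line\<close>

lemma norm_root_of_unity:
  fixes z :: complex
  assumes "z ^ n = 1" "n > 0" shows "cmod z = 1"
proof -
  have "cmod z ^ n = 1 ^ n" using assms(1) by (metis norm_one norm_power power_one)
  then show ?thesis using assms(2) by (intro power_eq_imp_eq_base[of "cmod z" n 1]) auto
qed

context odd_frobenius_closure
begin

lemma power_one_imp_GF:
  assumes "x ^ (q ^ n - 1) = 1" shows "x \<in> GF n"
proof -
  have "q ^ n = Suc (q ^ n - 1)" using q_gt_1 by simp
  then have "x ^ (q ^ n) = x * x ^ (q ^ n - 1)" by (metis power_Suc)
  then show ?thesis using assms by (simp add: GF_iff)
qed

text \<open>Elements of norm 1 are of the form \<open>z ^ (q\<^sup>2 - 1)\<close> by Hilbert's Theorem 90, so \<open>\<xi>\<close> is trivial on them and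
factors through the norm, which is surjective. Both facts come from taking roots in the algebraic
closure and checking that they lie in \<open>GF 4\<close>. If the order of \<open>\<xi>\<close> divides \<open>q + 1\<close>, then \<open>\<psi>\<close> is
trivial on the base field, whose nonzero elements are the \<open>(q + 1)\<close>-th powers in \<open>GF 2\<close>.\<close>

lemma descend_character:
  fixes \<xi> :: "'k \<Rightarrow> complex"
  assumes mult: "\<And>x y. x \<in> GF 4 \<Longrightarrow> y \<in> GF 4 \<Longrightarrow> x \<noteq> 0 \<Longrightarrow> y \<noteq> 0 \<Longrightarrow> \<xi> (x * y) = \<xi> x * \<xi> y"
    and ord: "\<And>x. x \<in> GF 4 \<Longrightarrow> x \<noteq> 0 \<Longrightarrow> \<xi> x ^ (q\<^sup>2 - 1) = 1"
    and nontriv: "u \<in> GF 4" "u \<noteq> 0" "\<xi> u \<noteq> 1"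
  obtains \<psi> :: "'k \<Rightarrow> complex" where "\<psi> 0 = 0" "\<psi> 1 = 1" "\<And>x. cmod (\<psi> x) \<le> 1"
    "\<And>x y. x \<in> GF 2 \<Longrightarrow> y \<in> GF 2 \<Longrightarrow> \<psi> (x * y) = \<psi> x * \<psi> y"
    "(\<Sum>x\<in>GF 2. \<psi> x) = 0"
    "\<And>w. w \<in> GF 4 \<Longrightarrow> w \<noteq> 0 \<Longrightarrow> \<psi> (w ^ (q\<^sup>2 + 1)) = \<xi> w"
    "\<And>a. (\<And>w. w \<in> GF 4 \<Longrightarrow> w \<noteq> 0 \<Longrightarrow> \<xi> w ^ (q + 1) = 1) \<Longrightarrow> a \<in> GF 1 \<Longrightarrow> a \<noteq> 0 \<Longrightarrow> \<psi> a = 1"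
proof -
  have q4: "(q\<^sup>2 - 1) * (q\<^sup>2 + 1) = q ^ 4 - 1"
  proof -
    have "q ^ 4 = q\<^sup>2 * q\<^sup>2" by (simp flip: power_add)
    then show ?thesis by (simp add: algebra_simps diff_mult_distrib)
  qed
  have xi_pow: "\<xi> (x ^ n) = \<xi> x ^ n" if "x \<in> GF 4" "x \<noteq> 0" "n > 0" for x n
    using that(3) by (induction n rule: nat_induct_non_zero) (use that mult GF_power in auto)
  have surj: "\<exists>w. w \<in> GF 4 \<and> w \<noteq> 0 \<and> w ^ (q\<^sup>2 + 1) = x" if x: "x \<in> GF 2" "x \<noteq> 0" for x
  proof -
    obtain w where w: "w ^ (q\<^sup>2 + 1) = x" using nth_root_exists[of "q\<^sup>2 + 1" x] by auto
    have "w ^ (q ^ 4 - 1) = x ^ (q\<^sup>2 - 1)" unfolding w[symmetric] q4[symmetric] by (metis power_mult mult.commute)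
    then have "w \<in> GF 4" using GF_nonzero_power[OF x] power_one_imp_GF by simp
    then show ?thesis using w x by auto
  qed
  define \<psi> where "\<psi> = (\<lambda>x. if x \<in> GF 2 \<and> x \<noteq> 0 then \<xi> (SOME w. w \<in> GF 4 \<and> w \<noteq> 0 \<and> w ^ (q\<^sup>2 + 1) = x) else 0)"
  have norm_GF2: "w ^ (q\<^sup>2 + 1) \<in> GF 2" if "w \<in> GF 4" for w
  proof -
    have "(w ^ (q\<^sup>2 + 1)) ^ q\<^sup>2 = w ^ (q ^ 4) * w ^ q\<^sup>2"
      by (simp add: algebra_simps flip: power_mult power_add)
    then show ?thesis using that by (simp add: GF_iff)
  qed
  have psi: "\<psi> (w ^ (q\<^sup>2 + 1)) = \<xi> w" if w: "w \<in> GF 4" "w \<noteq> 0" for w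
  proof -
    define v where "v = (SOME v. v \<in> GF 4 \<and> v \<noteq> 0 \<and> v ^ (q\<^sup>2 + 1) = w ^ (q\<^sup>2 + 1))"
    have v: "v \<in> GF 4" "v \<noteq> 0" "v ^ (q\<^sup>2 + 1) = w ^ (q\<^sup>2 + 1)"
      using someI[of "\<lambda>v. v \<in> GF 4 \<and> v \<noteq> 0 \<and> v ^ (q\<^sup>2 + 1) = w ^ (q\<^sup>2 + 1)" w] w by (auto simp: v_def)
    have "q\<^sup>2 - 1 > 0" using q2_gt by linarith
    then obtain z where z: "z ^ (q\<^sup>2 - 1) = v / w" using nth_root_exists by blast
    have "(v / w) ^ (q\<^sup>2 + 1) = 1" using v w by (simp add: power_divide)
    then have "z ^ (q ^ 4 - 1) = 1" unfolding q4[symmetric] power_mult z .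
    then have z4: "z \<in> GF 4" by (rule power_one_imp_GF)
    have z0: "z \<noteq> 0" using z v w q2_gt by (auto simp: power_0_left split: if_splits)
    have "\<xi> (v / w) = 1" using xi_pow[OF z4 z0, of "q\<^sup>2 - 1"] ord[OF z4 z0] z q2_gt by simp
    moreover have "\<xi> v = \<xi> (v / w) * \<xi> w" using mult[of "v / w" w] v w GF_divide by simp
    ultimately have "\<xi> v = \<xi> w" by simp
    then show ?thesis using norm_GF2[OF w(1)] w by (simp add: \<psi>_def v_def)
  qed
  have psi_0: "\<psi> 0 = 0" by (simp add: \<psi>_def)
  have psi_mult: "\<psi> (x * y) = \<psi> x * \<psi> y" if xy: "x \<in> GF 2" "y \<in> GF 2" for x y
  proof (cases "x = 0 \<or> y = 0")
    case False
    obtain w where w: "w \<in> GF 4" "w \<noteq> 0" "w ^ (q\<^sup>2 + 1) = x" using surj[of x] xy False by blast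
    obtain v where v: "v \<in> GF 4" "v \<noteq> 0" "v ^ (q\<^sup>2 + 1) = y" using surj[of y] xy False by blast
    have "\<psi> ((w * v) ^ (q\<^sup>2 + 1)) = \<xi> w * \<xi> v" using w v psi[of "w * v"] mult GF_mult by simp
    then show ?thesis using psi[OF w(1,2)] psi[OF v(1,2)] by (simp only: power_mult_distrib w(3) v(3))
  qed (auto simp: psi_0)
  have xi_1: "\<xi> 1 = 1"
  proof -
    have "\<xi> 1 * \<xi> 1 = \<xi> 1" using mult[of 1 1] by simp
    moreover have "\<xi> 1 \<noteq> 0" using ord[of 1] q2_gt by (auto simp: power_0_left split: if_splits)
    ultimately show ?thesis by simp
  qed
  have psi_1: "\<psi> 1 = 1" using psi[of 1] xi_1 by simp
  have le: "cmod (\<psi> x) \<le> 1" for x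
  proof (cases "x \<in> GF 2 \<and> x \<noteq> 0")
    case True
    then obtain w where w: "w \<in> GF 4" "w \<noteq> 0" "w ^ (q\<^sup>2 + 1) = x" using surj by blast
    have "cmod (\<xi> w) = 1" using norm_root_of_unity[OF ord[OF w(1,2)]] q2_gt by linarith
    then show ?thesis using psi[OF w(1,2)] w by simp
  qed (auto simp: \<psi>_def)
  have sum: "(\<Sum>x\<in>GF 2. \<psi> x) = 0"
    by (rule sum_character_zero[OF psi_mult, of 2 "u ^ (q\<^sup>2 + 1)"]) (use nontriv psi norm_GF2 in auto)
  have triv: "\<psi> a = 1" if xi: "\<And>w. w \<in> GF 4 \<Longrightarrow> w \<noteq> 0 \<Longrightarrow> \<xi> w ^ (q + 1) = 1" and a: "a \<in> GF 1" "a \<noteq> 0" for a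
  proof -
    obtain b where b: "b ^ (q + 1) = a" using nth_root_exists[of "q + 1" a] by auto
    have b0: "b \<noteq> 0" using b a by auto
    have "q\<^sup>2 - 1 = (q + 1) * (q - 1)" using q_gt_1 by (simp add: power2_eq_square algebra_simps diff_mult_distrib2)
    then have "b ^ (q\<^sup>2 - 1) = a ^ (q - 1)" by (metis b power_mult)
    then have b2: "b \<in> GF 2" using GF_nonzero_power[OF a] power_one_imp_GF[of b 2] by simp
    obtain w where w: "w \<in> GF 4" "w \<noteq> 0" "w ^ (q\<^sup>2 + 1) = b" using surj[OF b2 b0] by blast
    have "\<psi> (b ^ n) = \<psi> b ^ n" for n
      by (induction n) (use psi_1 psi_mult b2 GF_power in auto)
    then have "\<psi> a = \<xi> w ^ (q + 1)" using b psi[OF w(1,2)] w by metis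
    then show ?thesis using xi w by simp
  qed
  show ?thesis using that[OF psi_0 psi_1 le psi_mult sum psi triv] by blast
qed

text \<open>On the conic, \<open>v\<^sup>2 = t + \<Delta>/2\<close> with \<open>t\<close> in the base field. Conversely the square roots \<open>v\<close> of
\<open>t + \<Delta>/2\<close> satisfy \<open>v ^ q\<^sup>2 = v\<close> or \<open>v ^ q\<^sup>2 = - v\<close>, according to whether \<open>t + \<Delta>/2\<close> is a square in
\<open>GF 2\<close>; only the second kind lies on the conic. The sign in the argument of the quadratic character
does not matter because \<open>-1\<close> is a square in \<open>GF 2\<close>.\<close>

lemma conic_fibration:
  fixes f :: "'k \<Rightarrow> complex"
  assumes \<Delta>: "\<Delta> \<noteq> 0" "\<Delta> ^ q = - \<Delta>"
  defines "W \<equiv> {v. v ^ q\<^sup>2 = - v \<and> v\<^sup>2 - v ^ (2 * q) = \<Delta>}"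
  shows "(\<Sum>v\<in>W. f (v\<^sup>2 - \<Delta> / 2)) = (\<Sum>t\<in>GF 1. f t * (1 - quad_char (- \<Delta> / 2 - t)))"
proof -
  have two: "(2 :: 'k) ^ q = 2"
    using frob_add[of 1 1 1] by simp
  have half: "(\<Delta> / 2) ^ q = - (\<Delta> / 2)" using \<Delta> two by (simp add: power_divide)
  have D2: "\<Delta> / 2 \<noteq> - (\<Delta> / 2)" using \<Delta> two_neq_0 by (simp add: field_simps)
  have "(\<Delta> / 2) ^ q\<^sup>2 = \<Delta> / 2"
    using half odd_q by (simp add: power2_eq_square power_mult)
  then have D_GF2: "\<Delta> / 2 \<in> GF 2" by (simp add: GF_iff)
  have sub: "GF 1 \<subseteq> GF 2" by (rule GF_mono) simp
  have W4: "W \<subseteq> GF 4"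
  proof
    fix v assume "v \<in> W"
    then have "(v ^ (q ^ 2)) ^ (q ^ 2) = v" using frob_minus[of v 2] by (auto simp: W_def)
    then show "v \<in> GF 4" using frob_frob[of v 2 2] by (simp add: GF_iff)
  qed
  then have finW: "finite W" using finite_card_GF[of 4] finite_subset by auto
  have fin1: "finite (GF 1)" using GF1_finite .
  have into: "v\<^sup>2 - \<Delta> / 2 \<in> GF 1" if "v \<in> W" for v
  proof -
    have "(v\<^sup>2 - \<Delta> / 2) ^ q = (v\<^sup>2) ^ q - (\<Delta> / 2) ^ q" using frob_diff[of "v\<^sup>2" "\<Delta> / 2" 1] by simp
    also have "(v\<^sup>2) ^ q = v\<^sup>2 - \<Delta>" using that by (auto simp: W_def power_mult[symmetric])
    also have "v\<^sup>2 - \<Delta> - (\<Delta> / 2) ^ q = v\<^sup>2 - (\<Delta> - \<Delta> / 2)" by (simp add: half)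
    also have "\<Delta> - \<Delta> / 2 = \<Delta> / 2" using two_neq_0 by (simp add: field_simps)
    finally show ?thesis by (simp add: GF_iff)
  qed
  have "(\<Sum>v\<in>W. f (v\<^sup>2 - \<Delta> / 2)) = (\<Sum>t\<in>GF 1. \<Sum>v | v \<in> W \<and> v\<^sup>2 - \<Delta> / 2 = t. f (v\<^sup>2 - \<Delta> / 2))"
    by (rule sum.group[OF finW fin1, symmetric]) (use into in auto)
  also have "\<dots> = (\<Sum>t\<in>GF 1. f t * (1 - quad_char (- \<Delta> / 2 - t)))"
  proof (rule sum.cong)
    fix t assume t: "t \<in> GF 1"
    define x where "x = t + \<Delta> / 2"
    define h where "h = (q\<^sup>2 - 1) div 2"
    have xG: "x \<in> GF 2" using t sub D_GF2 by (auto simp: x_def intro: GF_add)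
    have xq: "x ^ q = t - \<Delta> / 2" using frob_add[of t "\<Delta> / 2" 1] t half by (simp add: x_def GF_iff)
    have x0: "x \<noteq> 0"
    proof
      assume 0: "x = 0"
      then have "t = - (\<Delta> / 2)" by (simp add: x_def eq_neg_iff_add_eq_0)
      moreover have "t = \<Delta> / 2" using xq 0 q_gt_1 by (simp add: power_0_left)
      ultimately show False using D2 by simp
    qed
    have "- \<Delta> / 2 - t = - 1 * x" by (simp add: x_def)
    then have "quad_char (- \<Delta> / 2 - t) = quad_char (- 1 * x)" by (simp only:)
    also have "\<dots> = quad_char x" using quad_char_mult[of "- 1" x] xG GF_minus[OF GF_1, of 2]
        quad_char_base_field[of "- 1"] GF_minus[OF GF_1, of 1] by simp
    finally have eta: "quad_char (- \<Delta> / 2 - t) = (if x ^ h = 1 then 1 else - 1)" using x0 by (simp add: quad_char_def h_def)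
    obtain s where s: "s ^ 2 = x" using nth_root_exists[of 2 x] by auto
    have s0: "s \<noteq> 0" using s x0 by auto
    have ne: "s \<noteq> - s" using s0 two_neq_0 by (metis add_eq_0_iff2 mult_2 mult_eq_0_iff)
    have W_iff: "v \<in> W \<longleftrightarrow> x ^ h = - 1" if v: "v\<^sup>2 = x" for v
    proof -
      have v0: "v \<noteq> 0" using v x0 by auto
      have "q\<^sup>2 = Suc (2 * h)" using even_q2 q2_gt by (simp add: h_def)
      then have "v ^ q\<^sup>2 = v * x ^ h" by (simp add: power_mult v)
      then have 1: "v ^ q\<^sup>2 = - v \<longleftrightarrow> x ^ h = - 1" using v0 by (metis mult_cancel_left mult_minus1_right)
      have "v\<^sup>2 - v ^ (2 * q) = x - x ^ q" by (simp add: v power_mult)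
      also have "\<dots> = \<Delta> / 2 + \<Delta> / 2" by (simp only: xq) (simp only: x_def, simp)
      also have "\<dots> = 2 * (\<Delta> / 2)" by (rule mult_2[symmetric])
      also have "\<dots> = \<Delta>" using two_neq_0 by simp
      finally show ?thesis using 1 by (simp add: W_def)
    qed
    have "{v. v \<in> W \<and> v\<^sup>2 - \<Delta> / 2 = t} = {v. v\<^sup>2 = x \<and> x ^ h = - 1}"
      using W_iff by (auto simp: x_def diff_eq_eq)
    also have "\<dots> = (if x ^ h = 1 then {} else {s, - s})"
    proof -
      have "x ^ h = 1 \<or> x ^ h = - 1" using half_power_cases[OF xG x0] by (simp only: h_def)
      moreover have "v\<^sup>2 = x \<longleftrightarrow> v = s \<or> v = - s" for v unfolding s[symmetric] by (rule power2_eq_iff)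
      ultimately show ?thesis using one_neq_minus_one by auto
    qed
    finally have fib: "{v. v \<in> W \<and> v\<^sup>2 - \<Delta> / 2 = t} = (if x ^ h = 1 then {} else {s, - s})" .
    have "(\<Sum>v | v \<in> W \<and> v\<^sup>2 - \<Delta> / 2 = t. f (v\<^sup>2 - \<Delta> / 2)) = of_nat (card {v. v \<in> W \<and> v\<^sup>2 - \<Delta> / 2 = t}) * f t"
      by simp
    also have "\<dots> = f t * (1 - quad_char (- \<Delta> / 2 - t))"
      unfolding fib eta using ne by simp
    finally show "(\<Sum>v | v \<in> W \<and> v\<^sup>2 - \<Delta> / 2 = t. f (v\<^sup>2 - \<Delta> / 2)) = f t * (1 - quad_char (- \<Delta> / 2 - t))" .
  qed simp
  finally show ?thesis .
qed

end

section \<open>The conic sum\<close>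

lemma finite_field_power_card:
  fixes x :: "'a::{field,finite}"
  shows "x ^ CARD('a) = x"
proof (cases "x = 0")
  case False
  \<comment> \<open>Multiplication by \<open>x\<close> permutes the nonzero elements and multiplies their product by a power of \<open>x\<close>.\<close>
  have "bij_betw ((*) x) (UNIV - {0}) (UNIV - {0})"
    by (rule bij_betwI[where g = "\<lambda>y. y / x"]) (use False in auto)
  then have "(\<Prod>y\<in>UNIV - {0}. x * y) = (\<Prod>y\<in>UNIV - {0 :: 'a}. y)"
    by (rule prod.reindex_bij_betw)
  then have "x ^ card (UNIV - {0 :: 'a}) * (\<Prod>y\<in>UNIV - {0 :: 'a}. y) = (\<Prod>y\<in>UNIV - {0}. y)"
    by (simp add: prod.distrib)
  moreover have "(\<Prod>y\<in>UNIV - {0 :: 'a}. y) \<noteq> 0" by simp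
  ultimately have "x ^ (CARD('a) - 1) = 1" by (simp add: card_Diff_singleton)
  moreover have "CARD('a) = Suc (CARD('a) - 1)" by simp
  ultimately show ?thesis by (metis mult_1_right power_Suc)
qed (simp add: power_0_left)

lemma of_nat_card_eq_0: "of_nat CARD('a) = (0 :: 'a::{field,finite})"
proof -
  have "bij_betw (\<lambda>y. y + 1) (UNIV :: 'a set) UNIV"
    by (rule bij_betwI[where g = "\<lambda>y. y - 1"]) auto
  then have "(\<Sum>y\<in>UNIV. y + 1) = (\<Sum>y\<in>(UNIV :: 'a set). y)"
    by (rule sum.reindex_bij_betw)
  then show ?thesis by (simp add: sum.distrib)
qed

text \<open>Adding up all elements shows that the number of elements vanishes in the field, so the characteristic
is the prime dividing \<open>q\<close>.\<close>

lemma frobenius_closure_alg_closure: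
  assumes "primepow q" and "CARD('a::{field,finite}) = q ^ 4"
  shows "frobenius_closure TYPE('a alg_closure) q"
proof unfold_locales
  have "CHAR('a) > 0" by (rule finite_imp_CHAR_pos) simp
  then have p: "prime CHAR('a)" by (rule prime_CHAR_semidom)
  then show "prime CHAR('a alg_closure)" by simp
  obtain r n where r: "prime r" "n > 0" "q = r ^ n" using assms(1) by (auto simp: primepow_def)
  have "CHAR('a) dvd q ^ 4" using of_nat_card_eq_0[where 'a = 'a] assms(2) of_nat_eq_0_iff_char_dvd by metis
  then have "CHAR('a) dvd r" using p r by (metis prime_dvd_power)
  then have "CHAR('a) = r" using p r by (metis primes_dvd_imp_eq)
  then show "\<exists>n>0. q = CHAR('a alg_closure) ^ n" using r by auto
qed

text \<open>A point with \<open>u = 0\<close> would give \<open>w ^ q = w\<close> or \<open>w ^ q = - w\<close>, hence \<open>w ^ q\<^sup>2 = w\<close>, which contradicts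
\<open>w ^ q\<^sup>2 = - w\<close>. So every point of the conic has a unique representative with \<open>u = 1\<close>.\<close>

lemma conic_sum_affine:
  fixes \<mu> \<Delta> :: "'a::field"
  assumes odd: "odd q" and two: "(2 :: 'a) \<noteq> 0"
  shows "conic_sum q \<mu> \<Delta> \<chi> = (\<Sum>v | v \<in> V_minus q \<and> Phi q v = \<Delta>. \<chi> (\<mu> * (v - 1 / 2)))"
proof -
  let ?W = "{v. v \<in> V_minus q \<and> Phi q v = \<Delta>}"
  have nzv: "(1, v) \<in> nonzero_vectors q" if "v \<in> ?W" for v
    using that by (simp add: nonzero_vectors_def fixed_subfield_def)
  have rf: "root_fun (proj_point q 1 v) = v - 1 / 2" if "v \<in> ?W" for v
    using root_fun_proj_point[OF nzv[OF that]] by simp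
  have bij: "bij_betw (proj_point q 1) ?W (conic_points q \<Delta>)"
  proof (rule bij_betwI')
    show "proj_point q 1 v = proj_point q 1 w \<longleftrightarrow> v = w" if "v \<in> ?W" "w \<in> ?W" for v w
    proof
      assume "proj_point q 1 v = proj_point q 1 w"
      then have "v - 1 / 2 = w - 1 / 2" by (simp only: rf[OF that(1), symmetric] rf[OF that(2), symmetric])
      then show "v = w" by simp
    qed simp
    show "proj_point q 1 v \<in> conic_points q \<Delta>" if "v \<in> ?W" for v
      using nzv[OF that] that unfolding conic_points_def by fastforce
    fix P assume "P \<in> conic_points q \<Delta>"
    then obtain u w where P: "P = proj_point q u w" and nz: "(u, w) \<in> nonzero_vectors q"
      and Ph: "Phi q w = \<Delta> * u\<^sup>2" by (auto simp: conic_points_def)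
    have u: "u ^ q = u" and w: "w ^ q\<^sup>2 = - w" using nz by (auto simp: nonzero_vectors_def fixed_subfield_def V_minus_def)
    have u0: "u \<noteq> 0"
    proof
      assume 0: "u = 0"
      then have w0: "w \<noteq> 0" using nz by (auto simp: nonzero_vectors_def)
      have "(w ^ q)\<^sup>2 = w\<^sup>2" using Ph 0 by (simp add: Phi_def mult.commute flip: power_mult)
      then have "w ^ q = w \<or> w ^ q = - w" by (simp add: power2_eq_iff)
      then have "(w ^ q) ^ q = w" using odd by auto
      then have "w = - w" using w by (simp add: power2_eq_square power_mult)
      then show False using w0 two by (metis add_eq_0_iff2 mult_2 mult_eq_0_iff)
    qed
    have uq: "u ^ q\<^sup>2 = u" using u by (simp add: power2_eq_square power_mult)
    have "(w / u) ^ q\<^sup>2 = - (w / u)" by (simp add: power_divide uq w)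
    moreover have "Phi q (w / u) = \<Delta>"
    proof -
      have "Phi q (w / u) = Phi q w / u\<^sup>2"
        using u by (simp add: Phi_def power_divide diff_divide_distrib mult.commute[of 2 q] power_mult)
      then show ?thesis using Ph u0 by simp
    qed
    ultimately have W: "w / u \<in> ?W" by (simp add: V_minus_def)
    have "((1, w / u), (u, w)) \<in> scaling_rel q"
      using nzv[OF W] nz u u0 by (auto simp: scaling_rel_def fixed_subfield_def intro!: bexI[of _ u])
    then have "P = proj_point q 1 (w / u)"
      unfolding P proj_point_def by (rule equiv_class_eq[OF equiv_scaling_rel, symmetric])
    then show "\<exists>v\<in>?W. P = proj_point q 1 v" using W by blast
  qed
  have "conic_sum q \<mu> \<Delta> \<chi> = (\<Sum>v\<in>?W. \<chi> (\<mu> * root_fun (proj_point q 1 v)))"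
    unfolding conic_sum_def by (rule sum.reindex_bij_betw[OF bij, symmetric])
  then show ?thesis using rf by simp
qed

text \<open>The least exponent in the definition of the order exists, because \<open>CARD('a) - 1\<close> is an exponent.\<close>

lemma character_power_order:
  fixes \<chi> :: "'a::{field,finite} \<Rightarrow> complex"
  assumes \<chi>: "mult_character \<chi>" and x: "x \<noteq> 0"
  shows "\<chi> x ^ character_order \<chi> = 1"
proof -
  have one: "\<chi> 1 = 1"
  proof -
    have "\<chi> 1 * \<chi> 1 = \<chi> 1" "\<chi> 1 \<noteq> 0"
      using \<chi> by (metis mult_character_def mult_1 one_neq_zero)+
    then show ?thesis by simp
  qed
  have pow: "\<chi> (y ^ n) = \<chi> y ^ n" if "y \<noteq> 0" for y n
    by (induction n) (use \<chi> one that in \<open>auto simp: mult_character_def\<close>)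
  have card: "CARD('a) > 1"
    using card_mono[of "UNIV :: 'a set" "{0, 1}"] by simp
  have "\<chi> y ^ (CARD('a) - 1) = 1" if y: "y \<noteq> 0" for y
  proof -
    have "CARD('a) = Suc (CARD('a) - 1)" by simp
    then have "y * y ^ (CARD('a) - 1) = y * 1" using finite_field_power_card[of y] by (metis mult_1_right power_Suc)
    then show ?thesis using y pow[OF y, of "CARD('a) - 1"] one by simp
  qed
  moreover have "\<chi> 0 = 0" using \<chi> by (simp add: mult_character_def)
  ultimately have "(\<lambda>y. \<chi> y ^ (CARD('a) - 1)) = trivial_character"
    using card by (auto simp: fun_eq_iff trivial_character_def power_0_left)
  then have "\<exists>n. n > 0 \<and> (\<lambda>y. \<chi> y ^ n) = trivial_character" using card by (intro exI[of _ "CARD('a) - 1"]) auto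
  then have "(\<lambda>y. \<chi> y ^ character_order \<chi>) = trivial_character"
    unfolding character_order_def by (rule LeastI2_ex) auto
  then show ?thesis using x by (metis trivial_character_def)
qed

theorem theorem3p3:
  fixes q d :: nat and \<mu> \<Delta> :: "'a::{field,finite}" and \<chi> :: "'a \<Rightarrow> complex"
  assumes "primepow q" and "odd q" and "CARD('a) = q ^ 4"
    and "\<mu> \<in> fixed_subfield q" and "\<mu> \<noteq> 0"
    and "\<Delta> \<in> fixed_subfield (q\<^sup>2)" and "\<Delta> \<noteq> 0" and "\<Delta> ^ q = - \<Delta>"
    and "mult_character \<chi>" and "\<chi> \<noteq> trivial_character"
    and "d = character_order \<chi>" and "d dvd q\<^sup>2 - 1"
  shows "cmod (conic_sum q \<mu> \<Delta> \<chi>) \<le> (if d dvd q + 1 then 2 * sqrt (real q) else 4 * sqrt (real q))"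
proof -
  interpret frobenius_closure q "TYPE('a alg_closure)"
    by (rule frobenius_closure_alg_closure[OF assms(1,3)])
  interpret odd_frobenius_closure q "TYPE('a alg_closure)"
    by unfold_locales (rule assms(2))
  have chi: "\<chi> 0 = 0" "\<And>x. x \<noteq> 0 \<Longrightarrow> \<chi> x \<noteq> 0" "\<And>x y. x \<noteq> 0 \<Longrightarrow> y \<noteq> 0 \<Longrightarrow> \<chi> (x * y) = \<chi> x * \<chi> y"
    using assms(9) by (auto simp: mult_character_def)
  have chi_d: "\<chi> x ^ d = 1" if "x \<noteq> 0" for x
    using character_power_order[OF assms(9) that] assms(11) by simp
  have chi_dvd: "\<chi> x ^ n = 1" if "x \<noteq> 0" "d dvd n" for x n
    using that chi_d by (auto elim!: dvdE simp: power_mult)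
  have ac_GF: "range (to_ac :: 'a \<Rightarrow> _) = GF 4"
  proof (rule card_subset_eq)
    show "finite (GF 4 :: 'a alg_closure set)" using finite_card_GF[of 4] by simp
    show "range (to_ac :: 'a \<Rightarrow> _) \<subseteq> GF 4"
    proof safe
      fix x :: 'a
      have "to_ac (x ^ (q ^ 4)) = to_ac x" using finite_field_power_card[of x] assms(3) by simp
      then show "to_ac x \<in> GF 4" by (simp add: GF_iff)
    qed
    show "card (range (to_ac :: 'a \<Rightarrow> _)) = card (GF 4 :: 'a alg_closure set)"
    proof -
      have "card (range (to_ac :: 'a \<Rightarrow> _)) = CARD('a)" by (rule card_image[OF inj_to_ac])
      then show ?thesis using finite_card_GF[of 4] assms(3) by simp
    qed
  qed
  \<comment> \<open>\<open>\<chi>\<close> transported to the subfield \<open>GF 4\<close> of the closure, which is the image of the given field.\<close>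
  define \<xi> where "\<xi> = (\<lambda>x. \<chi> (of_ac x))"
  have xi: "\<xi> (to_ac x) = \<chi> x" for x by (simp add: \<xi>_def)
  have ex_ac: "\<exists>y. x = to_ac y" if "x \<in> GF 4" for x using that ac_GF by blast
  obtain u where u: "u \<noteq> 0" "\<chi> u \<noteq> 1"
    using assms(10) chi(1) by (auto simp: fun_eq_iff trivial_character_def split: if_splits)
  have xi_mult: "\<xi> (x * y) = \<xi> x * \<xi> y" if xy: "x \<in> GF 4" "y \<in> GF 4" "x \<noteq> 0" "y \<noteq> 0" for x y
  proof -
    obtain x' y' where "x = to_ac x'" "y = to_ac y'" using ex_ac xy by blast
    then show ?thesis using chi(3)[of x' y'] xy xi[of "x' * y'"] by (simp add: xi)
  qed
  have xi_dvd: "\<xi> x ^ n = 1" if "x \<in> GF 4" "x \<noteq> 0" "d dvd n" for x n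
    using that ex_ac[of x] chi_dvd by (auto simp: xi)
  obtain \<psi> :: "'a alg_closure \<Rightarrow> complex" where psi: "\<psi> 0 = 0" "\<psi> 1 = 1" "\<And>x. cmod (\<psi> x) \<le> 1"
    "\<And>x y. x \<in> GF 2 \<Longrightarrow> y \<in> GF 2 \<Longrightarrow> \<psi> (x * y) = \<psi> x * \<psi> y"
    "(\<Sum>x\<in>GF 2. \<psi> x) = 0"
    "\<And>w. w \<in> GF 4 \<Longrightarrow> w \<noteq> 0 \<Longrightarrow> \<psi> (w ^ (q\<^sup>2 + 1)) = \<xi> w"
    "\<And>a. (\<And>w. w \<in> GF 4 \<Longrightarrow> w \<noteq> 0 \<Longrightarrow> \<xi> w ^ (q + 1) = 1) \<Longrightarrow> a \<in> GF 1 \<Longrightarrow> a \<noteq> 0 \<Longrightarrow> \<psi> a = 1"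
  proof (rule descend_character[of \<xi> "to_ac u"])
    show "\<xi> x ^ (q\<^sup>2 - 1) = 1" if "x \<in> GF 4" "x \<noteq> 0" for x using xi_dvd that assms(12) by blast
    show "to_ac u \<in> GF 4" using ac_GF by blast
  qed (use xi_mult u xi in auto)
  define \<delta> where "\<delta> = to_ac \<Delta>"
  have \<delta>: "\<delta> \<noteq> 0" "\<delta> ^ q = - \<delta>"
    using assms(7) arg_cong[OF assms(8), of to_ac] by (auto simp: \<delta>_def)
  have \<delta>2: "\<delta> \<in> GF 2"
    using \<delta> assms(2) by (simp add: GF_iff power2_eq_square power_mult)
  define c where "c = 1 / 4 - \<delta> / 2"
  define e where "e = - (\<delta> / 2)"
  have num: "(2 :: 'a alg_closure) ^ q = 2" "(4 :: 'a alg_closure) ^ q = 4"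
  proof -
    show 2: "(2 :: 'a alg_closure) ^ q = 2" using frob_add[of 1 1 1] by simp
    show "(4 :: 'a alg_closure) ^ q = 4" using frob_add[of 2 2 1] 2 by simp
  qed
  have two: "(2 :: 'a alg_closure) \<noteq> 0" by (rule two_neq_0)
  have four: "(4 :: 'a alg_closure) \<noteq> 0" using two by (metis mult_2_right mult_eq_0_iff numeral_Bit0)
  have cq: "c ^ q = 1 / 4 + \<delta> / 2"
    using frob_diff[of "1 / 4" "\<delta> / 2" 1] \<delta> num by (simp add: c_def power_divide)
  have eq: "e ^ q = \<delta> / 2"
    using frob_minus[of "\<delta> / 2" 1] \<delta> num by (simp add: e_def power_divide)
  have \<delta>n: "\<delta> \<noteq> - \<delta>" using \<delta>(1) two by (metis add_eq_0_iff2 mult_2 mult_eq_0_iff)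
  have half_sum: "\<delta> / 2 + \<delta> / 2 = \<delta>"
  proof -
    have "\<delta> / 2 + \<delta> / 2 = 2 * (\<delta> / 2)" by (rule mult_2[symmetric])
    then show ?thesis using two by simp
  qed
  have half_n: "\<delta> / 2 \<noteq> - (\<delta> / 2)"
  proof
    assume "\<delta> / 2 = - (\<delta> / 2)"
    then have "\<delta> / 2 + \<delta> / 2 = 0" by (simp only: eq_neg_iff_add_eq_0)
    then show False using half_sum \<delta>(1) by simp
  qed
  have num2: "(2 :: 'a alg_closure) \<in> GF 2" "(4 :: 'a alg_closure) \<in> GF 2"
    using num by (auto simp: GF_iff power2_eq_square power_mult)
  interpret conic_character q "TYPE('a alg_closure)" c e \<psi>
  proof unfold_locales
    show "c \<in> GF 2" "e \<in> GF 2" unfolding c_def e_def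
      using \<delta>2 num2 by (auto intro!: GF_diff GF_divide GF_minus)
    show "c ^ q \<noteq> c"
    proof
      assume "c ^ q = c"
      then have "1 / 4 + \<delta> / 2 = 1 / 4 + - (\<delta> / 2)" by (simp only: cq) (simp only: c_def diff_conv_add_uminus)
      then have "\<delta> / 2 = - (\<delta> / 2)" by (simp only: add_left_cancel)
      then show False using half_n by blast
    qed
    show "e ^ q \<noteq> e" unfolding eq unfolding e_def by (rule half_n)
    show "c \<noteq> e" using four by (simp add: c_def e_def)
    show "c \<noteq> e ^ q"
    proof
      assume ce: "c = e ^ q"
      then have "1 / 4 - \<delta> / 2 = \<delta> / 2" by (simp only: eq) (simp only: c_def)
      then have 1: "1 / 4 = \<delta>" using half_sum by (metis diff_eq_eq)
      have "\<delta> ^ q = \<delta>" unfolding 1[symmetric] using num by (simp add: power_divide)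
      then show False using \<delta>(2) \<delta>n by simp
    qed
  qed (use psi in auto)
  define W where "W = {v :: 'a alg_closure. v ^ q\<^sup>2 = - v \<and> v\<^sup>2 - v ^ (2 * q) = \<delta>}"
  have two_a: "(2 :: 'a) \<noteq> 0"
  proof
    assume "(2 :: 'a) = 0"
    then have "to_ac (2 :: 'a) = 0" by (simp only: to_ac_0)
    then show False using two by simp
  qed
  have W4: "W \<subseteq> GF 4"
  proof
    fix v assume "v \<in> W"
    then have "(v ^ (q ^ 2)) ^ (q ^ 2) = v" using frob_minus[of v 2] by (auto simp: W_def)
    then show "v \<in> GF 4" using frob_frob[of v 2 2] by (simp add: GF_iff)
  qed
  have bij: "bij_betw to_ac {v. v \<in> V_minus q \<and> Phi q v = \<Delta>} W"
  proof -
    have iff: "v \<in> V_minus q \<and> Phi q v = \<Delta> \<longleftrightarrow> to_ac v \<in> W" for v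
    proof -
      have "to_ac v \<in> W \<longleftrightarrow> to_ac (v ^ q\<^sup>2) = to_ac (- v) \<and> to_ac (v\<^sup>2 - v ^ (2 * q)) = to_ac \<Delta>"
        by (simp add: W_def \<delta>_def)
      then show ?thesis unfolding to_ac_eq_iff by (simp add: V_minus_def Phi_def)
    qed
    then have "to_ac ` {v. v \<in> V_minus q \<and> Phi q v = \<Delta>} = W" using W4 ex_ac by blast
    then show ?thesis using inj_to_ac by (auto simp: bij_betw_def inj_on_def)
  qed
  have val: "\<xi> (v - 1 / 2) = \<psi> (c - (v\<^sup>2 - \<delta> / 2))" if v: "v \<in> W" for v
  proof -
    have nz: "v - 1 / 2 \<noteq> 0"
    proof
      assume "v - 1 / 2 = 0"
      then have "v = 1 / 2" by simp
      then have "v \<in> GF 2" using GF_divide[OF GF_1 num2(1)] by (simp only:)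
      then have "v ^ q\<^sup>2 = v" by (simp only: GF_iff)
      then have "v = - v" using v by (simp add: W_def)
      then have "v = 0" using two by (metis add_eq_0_iff2 mult_2 mult_eq_0_iff)
      then show False using \<open>v = 1 / 2\<close> two by simp
    qed
    have "v - 1 / 2 \<in> GF 4" using v W4 num2 GF_mono[of 2 4] by (auto intro!: GF_diff GF_divide)
    then have "\<xi> (v - 1 / 2) = \<psi> ((v - 1 / 2) ^ (q\<^sup>2 + 1))" using psi(6) nz by simp
    \<comment> \<open>The conjugate of \<open>v\<close> over \<open>GF 2\<close> is \<open>- v\<close>.\<close>
    also have "(v - 1 / 2) ^ (q\<^sup>2 + 1) = (- v - 1 / 2) * (v - 1 / 2)"
    proof -
      have "(v - 1 / 2) ^ q\<^sup>2 = - v - 1 / 2"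
        using frob_diff[of v "1 / 2" 2] v num2 by (simp add: W_def GF_iff power_divide)
      then show ?thesis by (simp add: mult.commute)
    qed
    also have "\<dots> = c - (v\<^sup>2 - \<delta> / 2)"
    proof -
      have "(- v - 1 / 2) * (v - 1 / 2) = 1 / 2 * (1 / 2) - v\<^sup>2" by (simp add: algebra_simps power2_eq_square)
      also have "1 / 2 * (1 / 2) = (1 / 4 :: 'a alg_closure)" by simp
      finally show ?thesis by (simp add: c_def)
    qed
    finally show ?thesis .
  qed
  have "conic_sum q \<mu> \<Delta> \<chi> = (\<Sum>v | v \<in> V_minus q \<and> Phi q v = \<Delta>. \<chi> (\<mu> * (v - 1 / 2)))"
    by (rule conic_sum_affine[OF assms(2) two_a])
  also have "\<dots> = (\<Sum>v | v \<in> V_minus q \<and> Phi q v = \<Delta>. \<chi> \<mu> * \<xi> (to_ac v - 1 / 2))"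
  proof (rule sum.cong)
    fix v assume "v \<in> {v. v \<in> V_minus q \<and> Phi q v = \<Delta>}"
    have "\<xi> (to_ac v - 1 / 2) = \<chi> (v - 1 / 2)" using xi[of "v - 1 / 2"] by simp
    moreover have "\<chi> (\<mu> * y) = \<chi> \<mu> * \<chi> y" for y
      using chi assms(5) by (cases "y = 0") auto
    ultimately show "\<chi> (\<mu> * (v - 1 / 2)) = \<chi> \<mu> * \<xi> (to_ac v - 1 / 2)" by simp
  qed simp
  also have "\<dots> = (\<Sum>v\<in>W. \<chi> \<mu> * \<xi> (v - 1 / 2))"
    by (rule sum.reindex_bij_betw[OF bij])
  also have "\<dots> = \<chi> \<mu> * (\<Sum>v\<in>W. \<psi> (c - (v\<^sup>2 - \<delta> / 2)))"
    unfolding sum_distrib_left by (rule sum.cong) (use val in auto)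
  also have "(\<Sum>v\<in>W. \<psi> (c - (v\<^sup>2 - \<delta> / 2))) = (\<Sum>t\<in>GF 1. \<psi> (c - t) * (1 - quad_char (e - t)))"
    unfolding W_def using conic_fibration[OF \<delta>, of "\<lambda>t. \<psi> (c - t)"] by (simp add: e_def)
  finally have S: "conic_sum q \<mu> \<Delta> \<chi> = \<chi> \<mu> * (\<Sum>t\<in>GF 1. \<psi> (c - t) * (1 - quad_char (e - t)))" .
  have "cmod (\<chi> \<mu>) = 1"
    using norm_root_of_unity[OF chi_dvd[OF assms(5,12)]] q2_gt by linarith
  then have "cmod (conic_sum q \<mu> \<Delta> \<chi>) = cmod (\<Sum>t\<in>GF 1. \<psi> (c - t) * (1 - quad_char (e - t)))"
    unfolding S by (simp add: norm_mult)
  moreover have "\<psi> a = 1" if "d dvd q + 1" "a \<in> GF 1" "a \<noteq> 0" for a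
    using psi(7)[of a] xi_dvd that by blast
  ultimately show ?thesis using conic_bound by auto
qed

end
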